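(* Let $n\ge2$. The compact spaces $\mathcal{S}_0$ and $\mathcal{S}_1$ are $h$-equal but not homotopy equivalent.
   Context: Let $\mathcal{S}=S^n$ and $\mathcal{S}^2=S^n\times S^n$. $\mathcal{S}_0=\bigvee_{j\ge1}\mathcal{S}_0(j)$ is a compact (Hawaiian-earring type) wedge in $\mathbb{R}^{2n+2}$ of countably many copies $\mathcal{S}_0(j)$ of $S^n\times S^n$ at a common basepoint $s$ (the origin), the factors meeting pairwise only at $s$ and their diameters tending to $0$, with the subspace topology. $\mathcal{S}_1=\mathcal{S}\vee\mathcal{S}_0$ is the analogous compact wedge $\bigvee_{j\ge1}\mathcal{S}_1(j)$ in $\mathbb{R}^{2n+2}$ in which the first factor $\mathcal{S}_1(1)$ is a copy of $S^n$ and the factors $\mathcal{S}_1(j)$, $j\ge2$, are copies of $S^n\times S^n$. $X=_hY$ ($h$-equal) means there exist maps $f:X\to Y,\ g:Y\to X$ with $g\circ f\simeq\mathrm{id}_X$ and maps $f':Y\to X,\ g':X\to Y$ with $g'\circ f'\simeq\mathrm{id}_Y$. *)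

theory Defs
  imports "HOL-Analysis.Analysis"
begin

definition h_dominated :: "'a::topological_space set \<Rightarrow> 'b::topological_space set \<Rightarrow> bool" where
  "h_dominated X Y \<longleftrightarrow>
     (\<exists>f g. continuous_on X f \<and> f ` X \<subseteq> Y \<and> continuous_on Y g \<and> g ` Y \<subseteq> X \<and>
            homotopic_with_canon (\<lambda>h. True) X X (g \<circ> f) id)"

definition h_equal :: "'a::topological_space set \<Rightarrow> 'b::topological_space set \<Rightarrow> bool" where
  "h_equal X Y \<longleftrightarrow> h_dominated X Y \<and> h_dominated Y X"

text \<open>A compact (Hawaiian-earring type) wedge in the ambient space 'a: a union of a
  sequence of pieces A j, pairwise meeting only in the origin, diameters tending to 0.\<close>
definition shrinking_wedge :: "(nat \<Rightarrow> 'a::euclidean_space set) \<Rightarrow> bool" where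
  "shrinking_wedge A \<longleftrightarrow>
     (\<forall>i j. i \<noteq> j \<longrightarrow> A i \<inter> A j = {0}) \<and> (\<lambda>j. diameter (A j)) \<longlonglongrightarrow> 0"

end

theory Submission
  imports Defs
begin

text \<open>Each wedge dominates the other because a single sphere is a retract of the product of two
  spheres. To tell the homotopy types apart, use a map \<open>\<pi>\<close> from the product of two \<open>n\<close>-spheres
  onto a \<open>2n\<close>-sphere that collapses the axes and is essential; it plays the role of the cup
  product. Let \<open>r\<close> be the projection of the second wedge onto its single sphere and let \<open>\<psi>\<close> be any
  map from it to the sphere. Then \<open>\<pi> (r, \<psi>)\<close> factors through the \<open>n\<close>-sphere, hence is inessential.
  Given a homotopy equivalence, transport \<open>r\<close> to a map \<open>R\<close> on the first wedge and take for \<open>\<psi>\<close> the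
  coordinates of its pieces: for the restriction \<open>\<alpha>\<close> of \<open>R\<close> to each axis of each piece,
  \<open>\<pi> (\<alpha> x, y)\<close> is inessential. A map \<open>\<iota>\<close> from the \<open>n\<close>-sphere to the first wedge can be pushed into
  the axes, so \<open>\<pi> (R (\<iota> x), y)\<close> is inessential for every \<open>\<iota>\<close>. For the \<open>\<iota>\<close> that comes from the single
  sphere, \<open>R \<circ> \<iota>\<close> is homotopic to the identity, which contradicts that \<open>\<pi>\<close> is essential.\<close>

subsection \<open>Homotopies and their extension\<close>

text \<open>The first wedge is not locally contractible at the base point, and a map from the sphere
  may visit infinitely many pieces. What is glued are therefore null-homotopies in the target
  \<open>Y\<close>, one for each piece: they fit together because each is constant over the preimage
  of the base point, which is why homotopies relative to a set are needed. The tail of the wedge is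
  controlled by the continuity of \<open>R\<close> at the base point. Two base values are in play.
  The base point of each product is \<open>(p, p)\<close>, but \<open>R\<close> sends it to
  \<open>- p\<close>, and \<open>\<pi> (- p, y)\<close> does not depend on \<open>y\<close>. The map
  \<pi> collapses whole half-spheres and not only axes, which leaves the room in which
  \<open>null_axis\<close> slides \<open>y\<close> to \<open>p\<close>. The assumption n \<ge> 2
  enters as \<open>DIM('b) \<ge> 3\<close>, that is n + 3 < 2n + 2: this is the dimension count by
  which an approximation of a map into the product misses a point.\<close>

lemma homotopic_with_constI:
  fixes K :: "real \<times> 'a::topological_space \<Rightarrow> 'b::topological_space"
  assumes "continuous_on ({0..1} \<times> X) K" "K \<in> {0..1} \<times> X \<rightarrow> Y"
    and "\<And>x. x \<in> X \<Longrightarrow> K (0, x) = f x" "\<And>x. x \<in> X \<Longrightarrow> K (1, x) = g x"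
    and "Z \<subseteq> X" "\<And>t x. t \<in> {0..1} \<Longrightarrow> x \<in> Z \<Longrightarrow> K (t, x) = c"
  shows "homotopic_with_canon (\<lambda>h. \<forall>x\<in>Z. h x = c) X Y f g"
proof (subst homotopic_with)
  show "(\<forall>x\<in>Z. h x = c) \<longleftrightarrow> (\<forall>x\<in>Z. k x = c)"
    if "\<And>x. x \<in> topspace (top_of_set X) \<Longrightarrow> h x = k x" for h k
    using that assms(5) by (metis subsetD topspace_euclidean_subtopology)
  show "\<exists>h. continuous_map (prod_topology (top_of_set {0..1::real}) (top_of_set X)) (top_of_set Y) h \<and>
        (\<forall>x\<in>topspace (top_of_set X). h (0, x) = f x) \<and>
        (\<forall>x\<in>topspace (top_of_set X). h (1, x) = g x) \<and> (\<forall>t\<in>{0..1}. \<forall>x\<in>Z. h (t, x) = c)"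
    by (intro exI[of _ K] conjI ballI)
      (use assms in \<open>simp_all add: image_subset_iff_funcset\<close>)
qed

lemma homotopic_with_constE:
  assumes "homotopic_with_canon (\<lambda>h. \<forall>x\<in>Z. h x = c) X Y f g"
  obtains K :: "real \<times> 'a::topological_space \<Rightarrow> 'b::topological_space"
  where "continuous_on ({0..1} \<times> X) K" "K \<in> {0..1} \<times> X \<rightarrow> Y"
    and "\<And>x. K (0, x) = f x" "\<And>x. K (1, x) = g x"
    and "\<And>t x. t \<in> {0..1} \<Longrightarrow> x \<in> Z \<Longrightarrow> K (t, x) = c"
proof -
  obtain K where "continuous_map (prod_topology (top_of_set {0..1::real}) (top_of_set X)) (top_of_set Y) K"
      "(\<forall>x. K (0, x) = f x)" "(\<forall>x. K (1, x) = g x)" "(\<forall>t\<in>{0..1}. \<forall>x\<in>Z. K (t, x) = c)"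
    using assms unfolding homotopic_with_def by blast
  then show ?thesis
    by (intro that[of K]) (simp_all add: image_subset_iff_funcset)
qed

lemma homotopic_with_canonI:
  fixes K :: "real \<times> 'a::topological_space \<Rightarrow> 'b::topological_space"
  assumes "continuous_on ({0..1} \<times> X) K" "K \<in> {0..1} \<times> X \<rightarrow> Y"
    and "\<And>x. x \<in> X \<Longrightarrow> K (0, x) = f x" "\<And>x. x \<in> X \<Longrightarrow> K (1, x) = g x"
  shows "homotopic_with_canon (\<lambda>h. True) X Y f g"
  using homotopic_with_constI[OF assms, of "{}" undefined] by simp

lemma homotopic_with_canonE:
  assumes "homotopic_with_canon (\<lambda>h. True) X Y f g"
  obtains K :: "real \<times> 'a::topological_space \<Rightarrow> 'b::topological_space"
  where "continuous_on ({0..1} \<times> X) K" "K \<in> {0..1} \<times> X \<rightarrow> Y"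
    and "\<And>x. K (0, x) = f x" "\<And>x. K (1, x) = g x"
  using homotopic_with_constE[of "{}" undefined X Y f g] assms by auto

text \<open>Borsuk's theorem applied to \<open>(t, x) \<mapsto> f x\<close> on \<open>[0,1] \<times> T\<close>: on
  \<open>{0} \<times> T \<union> [0,1] \<times> S\<close> this map is homotopic to \<open>K\<close> via \<open>(s, (t, x)) \<mapsto> K (s t, x)\<close>.\<close>
lemma homotopy_extension:
  fixes f :: "'a::euclidean_space \<Rightarrow> 'b::euclidean_space"
  assumes S: "closedin (top_of_set T) S" and "ANR U"
    and f: "continuous_on T f" "f \<in> T \<rightarrow> U"
    and K: "continuous_on ({0..1} \<times> S) K" "K \<in> {0..1} \<times> S \<rightarrow> U" "\<And>x. x \<in> S \<Longrightarrow> K (0, x) = f x"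
  obtains K' :: "real \<times> 'a \<Rightarrow> 'b" where "continuous_on ({0..1} \<times> T) K'" "K' \<in> {0..1} \<times> T \<rightarrow> U"
    "\<And>x. x \<in> T \<Longrightarrow> K' (0, x) = f x"
    "\<And>t x. t \<in> {0..1} \<Longrightarrow> x \<in> S \<Longrightarrow> K' (t, x) = K (t, x)"
proof -
  define Q where "Q = {0} \<times> T \<union> {0..1::real} \<times> S"
  have ST: "S \<subseteq> T"
    using S closedin_subset by fastforce
  define M where "M = (\<lambda>(s::real, t::real, x). if x \<in> S then K (s * t, x) else f x)"
  define G where "G = (\<lambda>(t::real, x). M (1, t, x))"
  have mult01: "s * t \<in> {0..1}" if "s \<in> {0..1}" "t \<in> {0..1}" for s t :: real
    using that by (auto simp: mult_le_one)
  have clo1: "closedin (top_of_set ({0..1} \<times> T)) ({0::real} \<times> T)"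
    by (intro closedin_Times) auto
  have clo2: "closedin (top_of_set ({0..1} \<times> T)) ({0..1::real} \<times> S)"
    by (intro closedin_Times S) auto
  have cloQ: "closedin (top_of_set ({0..1} \<times> T)) Q"
    unfolding Q_def by (rule closedin_Un[OF clo1 clo2])
  have contM: "continuous_on ({0..1} \<times> Q) M"
  proof -
    have split: "{0..1} \<times> Q = {0..1::real} \<times> ({0} \<times> T) \<union> {0..1::real} \<times> ({0..1} \<times> S)"
      unfolding Q_def by blast
    have QT: "Q \<subseteq> {0..1} \<times> T"
      using ST by (auto simp: Q_def)
    have c1: "continuous_on ({0..1} \<times> ({0} \<times> T)) M"
    proof (rule continuous_on_eq)
      show "continuous_on ({0..1::real} \<times> ({0::real} \<times> T)) (\<lambda>z. f (snd (snd z)))"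
        by (intro continuous_on_compose2[OF f(1)] continuous_intros) auto
      show "f (snd (snd z)) = M z" if "z \<in> {0..1} \<times> ({0} \<times> T)" for z
        using that K(3) by (auto simp: M_def)
    qed
    have c2: "continuous_on ({0..1} \<times> ({0..1} \<times> S)) M"
    proof (rule continuous_on_eq)
      show "continuous_on ({0..1::real} \<times> ({0..1::real} \<times> S)) (\<lambda>z. K (fst z * fst (snd z), snd (snd z)))"
        using mult01 by (intro continuous_on_compose2[OF K(1)] continuous_intros) auto
    qed (auto simp: M_def)
    have cl1: "closedin (top_of_set ({0..1} \<times> Q)) ({0..1::real} \<times> ({0} \<times> T))"
      by (intro closedin_Times closedin_subset_trans[OF clo1 _ QT]) (simp_all add: Q_def)
    have cl2: "closedin (top_of_set ({0..1} \<times> Q)) ({0..1::real} \<times> ({0..1} \<times> S))"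
      by (intro closedin_Times closedin_subset_trans[OF clo2 _ QT]) (simp_all add: Q_def)
    show ?thesis
      using cl1 cl2 c1 c2 unfolding split by (rule continuous_on_Un_local)
  qed
  have hom: "homotopic_with_canon (\<lambda>h. True) Q U (\<lambda>z. f (snd z)) G"
  proof (rule homotopic_with_canonI[OF contM])
    show "M \<in> {0..1} \<times> Q \<rightarrow> U"
      using K(2) f(2) mult01 ST by (auto simp: M_def Q_def Pi_iff split: if_splits)
  qed (use K(3) in \<open>auto simp: M_def G_def Q_def\<close>)
  have f1: "continuous_on ({0..1::real} \<times> T) (\<lambda>z. f (snd z))"
    by (intro continuous_on_compose2[OF f(1)] continuous_intros) auto
  have f2: "(\<lambda>z. f (snd z)) \<in> {0..1::real} \<times> T \<rightarrow> U"
    using f(2) by auto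
  obtain K' where "continuous_on ({0..1::real} \<times> T) K'" "K' ` ({0..1} \<times> T) \<subseteq> U"
      "\<And>z. z \<in> Q \<Longrightarrow> K' z = G z"
    by (rule Borsuk_homotopy_extension_homotopic[OF cloQ disjI2[OF \<open>ANR U\<close>] f1 f2 hom])
      (rule that; assumption)
  then show ?thesis
    using K(3) by (intro that[of K']) (auto simp: Q_def G_def M_def)
qed

subsection \<open>Homogeneity of spheres\<close>

text \<open>The reflection in the hyperplane orthogonal to \<open>w\<close>. For
  \<open>w = 0\<close> the quotient is zero and the map is the identity, so it is an isometric
  involution for every \<open>w\<close>.\<close>

definition refl_along :: "'a::real_inner \<Rightarrow> 'a \<Rightarrow> 'a" where
  "refl_along w x = x - (2 * (x \<bullet> w) / (w \<bullet> w)) *\<^sub>R w"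

lemma refl_along_refl_along [simp]: "refl_along w (refl_along w x) = x"
proof (cases "w = 0")
  case False
  then have "refl_along w x \<bullet> w = - (x \<bullet> w)"
    by (simp add: refl_along_def inner_diff_left)
  then show ?thesis
    by (simp add: refl_along_def)
qed (simp add: refl_along_def)

lemma norm_refl_along [simp]: "norm (refl_along w x) = norm x"
proof (cases "w = 0")
  case False
  then have "refl_along w x \<bullet> refl_along w x = x \<bullet> x"
    by (simp add: refl_along_def inner_diff_left inner_diff_right inner_commute)
  then show ?thesis
    by (simp add: norm_eq_sqrt_inner)
qed (simp add: refl_along_def)

text \<open>Equal norms give \<open>2 * (a \<bullet> (a - b)) = (a - b) \<bullet> (a - b)\<close>,
  so the coefficient in the reflection is one.\<close>

lemma refl_along_diff:
  assumes "norm a = norm b"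
  shows "refl_along (a - b) a = b"
proof (cases "a = b")
  case False
  have eq: "a \<bullet> a = b \<bullet> b"
    using assms by (simp add: norm_eq)
  have "2 * (a \<bullet> (a - b)) = (a - b) \<bullet> (a - b)"
    using eq by (simp add: inner_diff_left inner_diff_right inner_commute)
  then have "2 * (a \<bullet> (a - b)) / ((a - b) \<bullet> (a - b)) = 1"
    using False by (metis divide_self inner_eq_zero_iff right_minus_eq)
  then show ?thesis
    unfolding refl_along_def by (simp only: scaleR_one) simp
qed (simp add: refl_along_def)

lemma continuous_on_refl_along [continuous_intros]:
  assumes "continuous_on S f" "continuous_on S g" "\<And>x. x \<in> S \<Longrightarrow> f x \<noteq> 0"
  shows "continuous_on S (\<lambda>x. refl_along (f x) (g x))"
  unfolding refl_along_def using assms by (intro continuous_intros) auto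

lemma continuous_on_refl_along_const: "continuous_on S (refl_along w)"
proof (cases "w = 0")
  case True
  then have "refl_along w = (\<lambda>x. x)"
    by (auto simp: refl_along_def)
  then show ?thesis by simp
qed (intro continuous_intros; simp)

text \<open>Reflect in the perpendicular bisector of \<open>a\<close> and \<open>b\<close>. This is
  needed because the given homeomorphisms of the pieces with their models say nothing about base
  points.\<close>

lemma homeomorphism_sphere_moving:
  fixes a b :: "'a::real_inner"
  assumes "a \<in> sphere 0 r" "b \<in> sphere 0 r"
  obtains f g where "homeomorphism (sphere 0 r) (sphere 0 r) f g" "f a = b"
proof
  show "homeomorphism (sphere 0 r) (sphere 0 r) (refl_along (a - b)) (refl_along (a - b))"
    by (intro homeomorphismI continuous_on_refl_along_const) auto
  show "refl_along (a - b) a = b"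
    using assms by (intro refl_along_diff) auto
qed

lemma homeomorphism_sphere_pointed:
  fixes q :: "'b::real_inner"
  assumes "A homeomorphic sphere (0::'b) 1" "a \<in> A" "q \<in> sphere 0 1"
  obtains h k where "homeomorphism A (sphere 0 1) h k" "h a = q"
proof -
  obtain h k where hk: "homeomorphism A (sphere (0::'b) 1) h k"
    using assms(1) unfolding homeomorphic_def by blast
  then have "h a \<in> sphere 0 1"
    using assms(2) by (auto simp: homeomorphism_def)
  then obtain f g where fg: "homeomorphism (sphere 0 1) (sphere 0 1) f g" "f (h a) = q"
    using homeomorphism_sphere_moving[of "h a" 1 q] assms(3) by metis
  show ?thesis
    using that[OF homeomorphism_compose[OF hk fg(1)]] fg(2) by simp
qed

lemma homeomorphism_torus_pointed:
  fixes q :: "'b::real_inner"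
  assumes "A homeomorphic sphere (0::'b) 1 \<times> sphere (0::'b) 1" "a \<in> A" "q \<in> sphere 0 1"
  obtains h k where "homeomorphism A (sphere 0 1 \<times> sphere 0 1) h k" "h a = (q, q)"
proof -
  let ?S = "sphere (0::'b) 1"
  obtain h k where hk: "homeomorphism A (?S \<times> ?S) h k"
    using assms(1) unfolding homeomorphic_def by blast
  then have "h a \<in> ?S \<times> ?S"
    using assms(2) by (auto simp: homeomorphism_def)
  then have ha: "fst (h a) \<in> ?S" "snd (h a) \<in> ?S"
    by (auto simp: mem_Times_iff)
  obtain f g where fg: "homeomorphism ?S ?S f g" "f (fst (h a)) = q"
    using homeomorphism_sphere_moving[OF ha(1) assms(3)] by metis
  obtain f' g' where fg': "homeomorphism ?S ?S f' g'" "f' (snd (h a)) = q"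
    using homeomorphism_sphere_moving[OF ha(2) assms(3)] by metis
  have "homeomorphism (?S \<times> ?S) (?S \<times> ?S) (\<lambda>z. (f (fst z), f' (snd z))) (\<lambda>z. (g (fst z), g' (snd z)))"
  proof (rule homeomorphismI)
    have c: "continuous_on (?S \<times> ?S) (\<lambda>z. (u (fst z), v (snd z)))"
      if "continuous_on ?S u" "continuous_on ?S v" for u v :: "'b \<Rightarrow> 'b"
      by (intro continuous_on_Pair continuous_on_compose2[OF that(1)] continuous_on_compose2[OF that(2)]
          continuous_on_fst continuous_on_snd continuous_on_id) auto
    show "continuous_on (?S \<times> ?S) (\<lambda>z. (f (fst z), f' (snd z)))"
      "continuous_on (?S \<times> ?S) (\<lambda>z. (g (fst z), g' (snd z)))"
      using fg(1) fg'(1) by (intro c; simp add: homeomorphism_def)+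
    have im: "f ` ?S = ?S" "g ` ?S = ?S" "f' ` ?S = ?S" "g' ` ?S = ?S"
      using fg(1) fg'(1) by (simp_all add: homeomorphism_def)
    show "(\<lambda>z. (f (fst z), f' (snd z))) ` (?S \<times> ?S) \<subseteq> ?S \<times> ?S"
      using imageI[of _ ?S f] imageI[of _ ?S f'] unfolding im by (auto simp del: mem_sphere_0)
    show "(\<lambda>z. (g (fst z), g' (snd z))) ` (?S \<times> ?S) \<subseteq> ?S \<times> ?S"
      using imageI[of _ ?S g] imageI[of _ ?S g'] unfolding im by (auto simp del: mem_sphere_0)
  qed (use homeomorphism_apply1[OF fg(1)] homeomorphism_apply2[OF fg(1)]
      homeomorphism_apply1[OF fg'(1)] homeomorphism_apply2[OF fg'(1)] in auto)
  from homeomorphism_compose[OF hk this] show ?thesis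
    by (rule that) (simp add: fg(2) fg'(2))
qed

subsection \<open>Shrinking wedges\<close>

text \<open>Compactness makes the pieces bounded, without which \<open>diameter\<close> would not
  bound distances, and closed, which the gluing arguments use.\<close>

locale compact_wedge =
  fixes A :: "nat \<Rightarrow> 'a::euclidean_space set"
  assumes wedge: "shrinking_wedge A" and compact_piece: "compact (A j)"
begin

lemma Int_pieces: "i \<noteq> j \<Longrightarrow> A i \<inter> A j = {0}"
  using wedge unfolding shrinking_wedge_def by blast

lemma zero_in_piece [simp]: "0 \<in> A j"
  using Int_pieces[of j "Suc j"] by force

lemma piece_unique: "x \<in> A i \<Longrightarrow> x \<in> A j \<Longrightarrow> x \<noteq> 0 \<Longrightarrow> i = j"
  using Int_pieces by blast

lemma pieces_small:
  assumes "e > 0"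
  obtains N where "\<And>j x. N \<le> j \<Longrightarrow> x \<in> A j \<Longrightarrow> norm x < e"
proof -
  have "(\<lambda>j. diameter (A j)) \<longlonglongrightarrow> 0"
    using wedge unfolding shrinking_wedge_def by blast
  then obtain N where N: "\<And>j. N \<le> j \<Longrightarrow> norm (diameter (A j) - 0) < e"
    using LIMSEQ_D[OF _ assms] by blast
  show ?thesis
  proof (rule that)
    fix j x assume "N \<le> j" "x \<in> A j"
    then have "dist x 0 \<le> diameter (A j)"
      by (intro diameter_bounded_bound compact_imp_bounded compact_piece) auto
    with N[OF \<open>N \<le> j\<close>] show "norm x < e"
      by simp
  qed
qed

text \<open>Away from 0 the union is locally finite: outside the ball of radius
  \<open>norm x / 2\<close> only finitely many compact pieces remain. The index set is arbitrary so
  as to cover both "all pieces but one" and tails.\<close>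

lemma closed_subwedge: "closed (\<Union>i\<in>J. A i)"
proof -
  have "x \<in> (\<Union>i\<in>J. A i)" if x: "x \<in> closure (\<Union>i\<in>J. A i)" for x
  proof (cases "x = 0")
    case True
    have "J \<noteq> {}"
      using x by auto
    then show ?thesis
      using True by auto
  next
    case False
    then obtain N where N: "\<And>j y. N \<le> j \<Longrightarrow> y \<in> A j \<Longrightarrow> norm y < norm x / 2"
      using pieces_small[of "norm x / 2"] by auto
    let ?F = "\<Union>i\<in>J \<inter> {..<N}. A i"
    have "closed ?F"
      by (intro closed_UN) (auto simp: compact_piece compact_imp_closed)
    have "(\<Union>i\<in>J. A i) \<subseteq> ?F \<union> cball 0 (norm x / 2)"
    proof clarify
      fix y i assume "i \<in> J" "y \<in> A i" "y \<notin> cball 0 (norm x / 2)"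
      then show "y \<in> ?F"
        using N[of i y] by (cases "i < N") auto
    qed
    then have "closure (\<Union>i\<in>J. A i) \<subseteq> ?F \<union> cball 0 (norm x / 2)"
      using \<open>closed ?F\<close> by (intro closure_minimal closed_Un) auto
    with x False show ?thesis
      by auto
  qed
  then have "closure (\<Union>i\<in>J. A i) \<subseteq> (\<Union>i\<in>J. A i)"
    by blast
  then show ?thesis
    using closure_subset_eq by blast
qed

text \<open>Near a nonzero point of \<open>A i\<close> the wedge coincides with \<open>A i\<close>,
  since the union of the other pieces is closed. At 0 continuity on every piece would not suffice;
  the second assumption controls the tail uniformly, which leaves a minimum of finitely many
  radii.\<close>

lemma continuous_on_wedge:
  fixes F :: "'a \<Rightarrow> 'c::metric_space"
  assumes cont: "\<And>j. continuous_on (A j) F"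
    and small: "\<And>e. e > 0 \<Longrightarrow> \<exists>N. \<forall>j\<ge>N. \<forall>x\<in>A j. dist (F x) (F 0) < e"
  shows "continuous_on (\<Union>j. A j) F"
  unfolding continuous_on_eq_continuous_within
proof
  fix z assume "z \<in> (\<Union>j. A j)"
  then obtain i where i: "z \<in> A i" by blast
  show "continuous (at z within (\<Union>j. A j)) F"
  proof (cases "z = 0")
    case True
    show ?thesis
      unfolding continuous_within_eps_delta
    proof (intro allI impI)
      fix e :: real assume "e > 0"
      then obtain N where N: "\<And>j x. N \<le> j \<Longrightarrow> x \<in> A j \<Longrightarrow> dist (F x) (F 0) < e"
        using small by blast
      have "\<exists>d>0. \<forall>x\<in>A j. dist x 0 < d \<longrightarrow> dist (F x) (F 0) < e" for j
        using cont[of j] \<open>e > 0\<close> unfolding continuous_on_iff by (metis zero_in_piece)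
      then obtain d where d: "\<And>j. d j > 0" "\<And>j x. x \<in> A j \<Longrightarrow> dist x 0 < d j \<Longrightarrow> dist (F x) (F 0) < e"
        by metis
      \<comment> \<open>The 1 keeps the set nonempty when \<open>N = 0\<close>.\<close>
      define \<delta> where "\<delta> = Min (insert 1 (d ` {..<N}))"
      have "\<delta> > 0"
        unfolding \<delta>_def using d(1) by (subst Min_gr_iff) auto
      have le: "\<delta> \<le> d j" if "j < N" for j
        unfolding \<delta>_def using that by (intro Min_le) auto
      have "dist (F x) (F z) < e" if x: "x \<in> A j" "dist x z < \<delta>" for x j
      proof (cases "j < N")
        case True
        then show ?thesis
          using d(2)[OF x(1)] x(2) le[OF True] \<open>z = 0\<close> by simp
      next
        case False
        then show ?thesis
          using N[of j x] x(1) \<open>z = 0\<close> by simp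
      qed
      then show "\<exists>d>0. \<forall>x\<in>(\<Union>j. A j). dist x z < d \<longrightarrow> dist (F x) (F z) < e"
        using \<open>\<delta> > 0\<close> by blast
    qed
  next
    case False
    define U where "U = - (\<Union>j\<in>-{i}. A j)"
    have "open U"
      unfolding U_def by (rule open_Compl[OF closed_subwedge])
    have "z \<in> U"
      using piece_unique[OF i _ False] by (auto simp: U_def)
    have "(\<Union>j. A j) \<inter> U - {z} = A i \<inter> U - {z}"
      by (auto simp: U_def)
    then have "at z within (\<Union>j. A j) = at z within A i"
      using at_within_nhd[OF \<open>z \<in> U\<close> \<open>open U\<close>] by blast
    then show ?thesis
      using cont[of i] i by (simp add: continuous_on_eq_continuous_within)
  qed
qed

text \<open>The piece containing \<open>x\<close> is unique except at 0, where all the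
  \<open>\<phi> j\<close> agree.\<close>

lemma wedge_glue:
  fixes \<phi> :: "nat \<Rightarrow> 'a \<Rightarrow> 'c"
  assumes "\<And>j. \<phi> j 0 = c"
  obtains F where "\<And>j x. x \<in> A j \<Longrightarrow> F x = \<phi> j x"
proof
  fix j x assume x: "x \<in> A j"
  show "(\<lambda>x. \<phi> (SOME j. x \<in> A j) x) x = \<phi> j x"
  proof (cases "x = 0")
    case False
    then have "(SOME j. x \<in> A j) = j"
      using x by (intro some_equality) (auto dest: piece_unique)
    then show ?thesis by simp
  qed (simp add: assms)
qed

definition collapse :: "nat set \<Rightarrow> 'a \<Rightarrow> 'a" where
  "collapse J x = (if x \<in> (\<Union>j\<in>J. A j) then x else 0)"

lemma collapse_id: "j \<in> J \<Longrightarrow> x \<in> A j \<Longrightarrow> collapse J x = x"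
  by (auto simp: collapse_def)

lemma collapse_zero: "j \<notin> J \<Longrightarrow> x \<in> A j \<Longrightarrow> collapse J x = 0"
  using piece_unique by (auto simp: collapse_def)

lemma collapse_in: "J \<noteq> {} \<Longrightarrow> collapse J x \<in> (\<Union>j\<in>J. A j)"
  by (auto simp: collapse_def)

lemma continuous_on_collapse: "continuous_on (\<Union>j. A j) (collapse J)"
proof (rule continuous_on_wedge)
  show "continuous_on (A j) (collapse J)" for j
  proof (cases "j \<in> J")
    case True
    then show ?thesis
      by (intro continuous_on_eq[OF continuous_on_id]) (auto simp: collapse_id)
  next
    case False
    then show ?thesis
      by (intro continuous_on_eq[OF continuous_on_const]) (auto simp: collapse_zero)
  qed
next
  fix e :: real assume "e > 0"
  then obtain N where "\<And>j x. N \<le> j \<Longrightarrow> x \<in> A j \<Longrightarrow> norm x < e"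
    using pieces_small by blast
  then have "\<forall>j\<ge>N. \<forall>x\<in>A j. dist (collapse J x) (collapse J 0) < e"
    using \<open>e > 0\<close> by (auto simp: collapse_def)
  then show "\<exists>N. \<forall>j\<ge>N. \<forall>x\<in>A j. dist (collapse J x) (collapse J 0) < e" ..
qed

end

section \<open>Domination between wedges\<close>

text \<open>The first wedge is a retract of the second, piece by piece; pieces outside the range of
  \<sigma> are sent to 0. Continuity of \<open>F\<close> at 0 uses injectivity: only finitely many
  \<open>\<sigma> j\<close> lie below a given bound.\<close>

lemma h_dominated_wedge:
  fixes A :: "nat \<Rightarrow> 'a::euclidean_space set" and B :: "nat \<Rightarrow> 'b::euclidean_space set"
  assumes "compact_wedge A" "compact_wedge B" and \<sigma>: "inj \<sigma>"
    and f: "\<And>j. continuous_on (A j) (f j)" "\<And>j. f j ` A j \<subseteq> B (\<sigma> j)" "\<And>j. f j 0 = 0"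
    and g: "\<And>j. continuous_on (B (\<sigma> j)) (g j)" "\<And>j. g j ` B (\<sigma> j) \<subseteq> A j" "\<And>j. g j 0 = 0"
    and gf: "\<And>j x. x \<in> A j \<Longrightarrow> g j (f j x) = x"
  shows "h_dominated (\<Union>j. A j) (\<Union>j. B j)"
proof -
  interpret A: compact_wedge A by fact
  interpret B: compact_wedge B by fact
  define g' where "g' i = (if i \<in> range \<sigma> then g (inv \<sigma> i) else (\<lambda>_. 0))" for i
  obtain F where F: "\<And>j x. x \<in> A j \<Longrightarrow> F x = f j x"
    using A.wedge_glue[of f 0] f(3) by metis
  have "g' i 0 = 0" for i
    using g(3) by (auto simp: g'_def)
  then obtain G where G: "\<And>i x. x \<in> B i \<Longrightarrow> G x = g' i x"
    using B.wedge_glue[of g' 0] by metis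
  have G\<sigma>: "G x = g j x" if "x \<in> B (\<sigma> j)" for j x
    using G[OF that] \<sigma> by (simp add: g'_def)
  have F0: "F 0 = 0" and G0: "G 0 = 0"
    using F[of 0 0] G\<sigma>[of 0 0] f(3) g(3) by auto
  have contF: "continuous_on (\<Union>j. A j) F"
  proof (rule A.continuous_on_wedge)
    show "continuous_on (A j) F" for j
      using f(1) by (rule continuous_on_eq) (simp add: F)
    fix e :: real assume "e > 0"
    then obtain M where M: "\<And>i x. M \<le> i \<Longrightarrow> x \<in> B i \<Longrightarrow> norm x < e"
      using B.pieces_small by blast
    have "finite (\<sigma> -` {..<M})"
      using \<sigma> by (simp add: finite_vimageI)
    then obtain N where N: "\<And>j. j \<in> \<sigma> -` {..<M} \<Longrightarrow> j < N"
      by (meson finite_nat_set_iff_bounded)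
    have "norm (f j x) < e" if "N \<le> j" "x \<in> A j" for j x
    proof (rule M)
      show "M \<le> \<sigma> j"
        using N[of j] that(1) by (force simp: not_less[symmetric])
      show "f j x \<in> B (\<sigma> j)"
        using f(2) that(2) by blast
    qed
    then show "\<exists>N. \<forall>j\<ge>N. \<forall>x\<in>A j. dist (F x) (F 0) < e"
      by (intro exI[of _ N]) (simp add: F F0 f(3))
  qed
  have contG: "continuous_on (\<Union>j. B j) G"
  proof (rule B.continuous_on_wedge)
    show "continuous_on (B i) G" for i
    proof (cases "i \<in> range \<sigma>")
      case True
      then obtain j where "i = \<sigma> j" by blast
      then show ?thesis
        using continuous_on_eq[OF g(1)[of j], of G] by (simp add: G\<sigma>)
    next
      case False
      then show ?thesis
        by (intro continuous_on_eq[OF continuous_on_const[of _ 0]]) (simp add: G g'_def)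
    qed
    fix e :: real assume "e > 0"
    then obtain M where M: "\<And>i x. M \<le> i \<Longrightarrow> x \<in> A i \<Longrightarrow> norm x < e"
      using A.pieces_small by blast
    obtain N where N: "\<And>i. i \<in> \<sigma> ` {..<M} \<Longrightarrow> i < N"
      by (meson finite_nat_set_iff_bounded finite_imageI finite_lessThan)
    have "norm (G x) < e" if "N \<le> i" "x \<in> B i" for i x
    proof (cases "i \<in> range \<sigma>")
      case True
      then obtain j where j: "i = \<sigma> j" by blast
      have "M \<le> j"
        using N[of i] that(1) j by (force simp: not_less[symmetric])
      moreover have "g j x \<in> A j"
        using g(2)[of j] that(2) j by blast
      ultimately show ?thesis
        using M that(2) j by (simp add: G\<sigma>)
    next
      case False
      then show ?thesis
        using that \<open>e > 0\<close> by (simp add: G g'_def)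
    qed
    then show "\<exists>N. \<forall>i\<ge>N. \<forall>x\<in>B i. dist (G x) (G 0) < e"
      by (intro exI[of _ N]) (simp add: G0)
  qed
  have FB: "F x \<in> B (\<sigma> j)" if "x \<in> A j" for j x
    using f(2) that by (auto simp: F)
  have FX: "F ` (\<Union>j. A j) \<subseteq> (\<Union>j. B j)"
    using FB by blast
  have GX: "G ` (\<Union>j. B j) \<subseteq> (\<Union>j. A j)"
  proof clarify
    fix i x assume "x \<in> B i"
    then show "G x \<in> (\<Union>j. A j)"
      using g(2)[of "inv \<sigma> i"] by (cases "i \<in> range \<sigma>") (auto simp: G g'_def f_inv_into_f)
  qed
  have "homotopic_with_canon (\<lambda>h. True) (\<Union>j. A j) (\<Union>j. A j) (G \<circ> F) id"
  proof (rule homotopic_with_id2, clarsimp)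
    fix j x assume "x \<in> A j"
    then show "G (F x) = x"
      using G\<sigma>[OF FB] F gf by metis
  qed
  then show ?thesis
    unfolding h_dominated_def using contF contG FX GX by blast
qed

subsection \<open>Compressing maps from a sphere into the axes of a product of two spheres\<close>

lemma inner_less_one:
  fixes x y :: "'a::real_inner"
  assumes "x \<in> sphere 0 1" "y \<in> sphere 0 1" "x \<noteq> y"
  shows "x \<bullet> y < 1"
proof -
  have "0 < (x - y) \<bullet> (x - y)"
    using assms(3) by simp
  also have "\<dots> = 2 - 2 * (x \<bullet> y)"
    using assms(1,2) by (simp add: inner_diff_left inner_diff_right inner_commute norm_eq_1)
  finally show ?thesis by simp
qed

text \<open>The ray from \<open>d\<close> through the chord point \<open>(1 - t) x + t p\<close> meets the sphere again in the
  mirror image of \<open>d\<close>; as \<open>t\<close> varies this contracts the sphere without \<open>d\<close> to \<open>p\<close>.\<close>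
lemma sphere_expand:
  fixes p d :: "'b::euclidean_space"
  assumes d: "d \<in> sphere 0 1" and K: "closed K" "K \<subseteq> sphere 0 1" "d \<notin> K" and p: "p \<in> K"
  obtains E :: "real \<times> 'b \<Rightarrow> 'b" where "continuous_on ({0..1} \<times> sphere 0 1) E"
    "E \<in> {0..1} \<times> sphere 0 1 \<rightarrow> sphere 0 1" "\<And>x. x \<in> sphere 0 1 \<Longrightarrow> E (0, x) = x"
    "\<And>t. t \<in> {0..1} \<Longrightarrow> E (t, p) = p" "\<And>x. x \<in> K \<Longrightarrow> E (1, x) = p"
proof -
  define H :: "real \<times> 'b \<Rightarrow> 'b"
    where "H = (\<lambda>z. refl_along (d - ((1 - fst z) *\<^sub>R snd z + fst z *\<^sub>R p)) d)"
  \<comment> \<open>Pairing with \<open>d\<close> gives a convex combination of two numbers below 1,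
    which cannot equal \<open>d \<bullet> d = 1\<close>.\<close>
  have chord: "d - ((1 - t) *\<^sub>R x + t *\<^sub>R p) \<noteq> 0" if "t \<in> {0..1}" "x \<in> K" for t x
  proof
    assume "d - ((1 - t) *\<^sub>R x + t *\<^sub>R p) = 0"
    then have "d = (1 - t) *\<^sub>R x + t *\<^sub>R p" by simp
    then have "d \<bullet> d = (1 - t) * (x \<bullet> d) + t * (p \<bullet> d)"
      by (metis inner_add_left inner_scaleR_left)
    moreover have "x \<bullet> d < 1" "p \<bullet> d < 1"
      using inner_less_one[OF _ d] that K p by blast+
    ultimately have "(1 - t) * (1 - x \<bullet> d) + t * (1 - p \<bullet> d) = 0"
      using d by (simp add: norm_eq_1 algebra_simps)
    moreover have "(1 - t) * (1 - x \<bullet> d) \<ge> 0" "t * (1 - p \<bullet> d) \<ge> 0"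
      using that \<open>x \<bullet> d < 1\<close> \<open>p \<bullet> d < 1\<close> by auto
    ultimately have "(1 - t) * (1 - x \<bullet> d) = 0" "t * (1 - p \<bullet> d) = 0"
      by linarith+
    then show False
      using \<open>x \<bullet> d < 1\<close> \<open>p \<bullet> d < 1\<close> by auto
  qed
  have contH: "continuous_on ({0..1} \<times> K) H"
    unfolding H_def
  proof (intro continuous_intros)
    show "d - ((1 - fst z) *\<^sub>R snd z + fst z *\<^sub>R p) \<noteq> 0" if "z \<in> {0..1} \<times> K" for z
      using chord[of "fst z" "snd z"] that by auto
  qed
  have H0: "H (0, x) = x" if "x \<in> sphere 0 1" for x
    using d that by (auto simp: H_def intro!: refl_along_diff)
  have Hp: "H (t, p) = p" for t
  proof -
    have "(1 - t) *\<^sub>R p + t *\<^sub>R p = p"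
      by (simp flip: scaleR_add_left)
    then show ?thesis
      using d p K by (auto simp: H_def intro!: refl_along_diff)
  qed
  have H1: "H (1, x) = p" for x
    using d p K by (auto simp: H_def intro!: refl_along_diff)
  have clo: "closedin (top_of_set (sphere 0 1)) K"
    using K by (simp add: closed_subset)
  have HS: "H \<in> {0..1} \<times> K \<rightarrow> sphere 0 1"
    using d by (auto simp: H_def)
  \<comment> \<open>A chord that starts outside \<open>K\<close> may pass through \<open>d\<close>,
    so \<open>H\<close> is used on \<open>K\<close> only; on the rest of the sphere homotopy
    extension supplies the values.\<close>
  obtain E where E: "continuous_on ({0..1} \<times> sphere 0 1) E"
    "E \<in> {0..1} \<times> sphere 0 1 \<rightarrow> sphere 0 1" "\<And>x. x \<in> sphere 0 1 \<Longrightarrow> E (0, x) = x"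
    "\<And>t x. t \<in> {0..1} \<Longrightarrow> x \<in> K \<Longrightarrow> E (t, x) = H (t, x)"
  proof (rule homotopy_extension[OF clo ANR_sphere continuous_on_id _ contH HS])
    show "H (0, x) = x" if "x \<in> K" for x
      using H0 K(2) that by blast
  qed auto
  show ?thesis
    by (rule that[OF E(1-3)]) (use p in \<open>auto simp: E(4) Hp H1\<close>)
qed

section \<open>Radial normalisation and general position\<close>

text \<open>With \<open>nrmlz 0 = 0\<close> the identity \<open>nrmlz_scale\<close> holds for every
  vector.\<close>

definition nrmlz :: "'a::real_normed_vector \<Rightarrow> 'a" where
  "nrmlz v = v /\<^sub>R norm v"

lemma norm_nrmlz [simp]: "v \<noteq> 0 \<Longrightarrow> norm (nrmlz v) = 1"
  by (simp add: nrmlz_def)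

lemma nrmlz_unit [simp]: "norm v = 1 \<Longrightarrow> nrmlz v = v"
  by (simp add: nrmlz_def)

lemma nrmlz_scale: "norm v *\<^sub>R nrmlz v = v"
  by (cases "v = 0") (simp_all add: nrmlz_def)

lemma continuous_on_nrmlz [continuous_intros]:
  "continuous_on S f \<Longrightarrow> (\<And>x. x \<in> S \<Longrightarrow> f x \<noteq> 0) \<Longrightarrow> continuous_on S (\<lambda>x. nrmlz (f x))"
  unfolding nrmlz_def by (intro continuous_intros) auto

text \<open>Normalising moves \<open>v\<close> by the difference of \<open>norm v\<close> and 1,
  which is at most its distance from the unit vector \<open>w\<close>; the other half of the bound
  is that distance itself.\<close>

lemma norm_nrmlz_diff:
  assumes "norm w = 1" "v \<noteq> 0"
  shows "norm (nrmlz v - w) \<le> 2 * norm (v - w)"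
proof -
  have "nrmlz v - v = (1 - norm v) *\<^sub>R nrmlz v"
    by (simp add: scaleR_diff_left nrmlz_scale)
  then have "norm (nrmlz v - v) = \<bar>norm w - norm v\<bar>"
    using assms by simp
  also have "\<dots> \<le> norm (v - w)"
    using norm_triangle_ineq3[of w v] by (simp add: norm_minus_commute)
  finally show ?thesis
    using norm_triangle_ineq[of "nrmlz v - v" "v - w"] by simp
qed

lemma norm_fst_snd_le: "norm (fst z) \<le> norm z" "norm (snd z) \<le> norm z"
  by (cases z; simp add: norm_fst_le norm_snd_le)+

text \<open>Away from the base point the map is replaced by a normalised polynomial map, whose
  image is negligible.\<close>
lemma homotopic_missing_point:
  fixes p :: "'b::euclidean_space"
  assumes dim: "DIM('b) \<ge> 3" and p: "p \<in> sphere 0 1"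
    and u: "continuous_on (sphere 0 1) u" "u \<in> sphere (0::'b) 1 \<rightarrow> sphere 0 1 \<times> sphere 0 1"
  obtains u' d1 d2 where
    "homotopic_with_canon (\<lambda>h. \<forall>x\<in>{x\<in>sphere 0 1. u x = (p, p)}. h x = (p, p))
       (sphere 0 1) (sphere 0 1 \<times> sphere 0 1) u u'"
    "d1 \<in> sphere 0 1" "d2 \<in> sphere 0 1" "d1 \<noteq> p" "d2 \<noteq> p" "(d1, d2) \<notin> u' ` sphere 0 1"
proof -
  let ?S = "sphere (0::'b) 1"
  \<comment> \<open>Error 1/8 keeps both coordinates nonzero during the homotopy; normalising at
    most doubles it, to 1/4.\<close>
  obtain P where P: "polynomial_function P" "\<And>x. x \<in> ?S \<Longrightarrow> norm (u x - P x) < 1/8"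
    using Stone_Weierstrass_polynomial_function[OF compact_sphere u(1), of "1/8"] by auto
  have contP: "continuous_on ?S P"
    by (rule continuous_on_polymonial_function[OF P(1)])
  \<comment> \<open>The weight is 0 exactly where \<open>u\<close> is at the base point, so the
    homotopy rests there. It is 1 at distance at least 1 from it, where the end map is the
    normalised polynomial.\<close>
  define \<mu> where "\<mu> x = min 1 (norm (u x - (p, p)))" for x
  define v where "v t x = u x + (t * \<mu> x) *\<^sub>R (P x - u x)" for t x
  define K where "K z = (nrmlz (fst (v (fst z) (snd z))), nrmlz (snd (v (fst z) (snd z))))" for z
  have uS: "norm (fst (u x)) = 1" "norm (snd (u x)) = 1" if "x \<in> ?S" for x
    using u(2) that by (auto simp: Pi_iff mem_Times_iff)
  have vu: "norm (v t x - u x) \<le> 1/8" if "t \<in> {0..1}" "x \<in> ?S" for t x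
  proof -
    have "0 \<le> t * \<mu> x" "t * \<mu> x \<le> 1"
      using that(1) by (auto simp: \<mu>_def mult_le_one)
    then have "norm (v t x - u x) \<le> 1 * norm (P x - u x)"
      unfolding v_def by (simp add: mult_left_le_one_le)
    then show ?thesis
      using P(2)[OF that(2)] by (simp add: norm_minus_commute)
  qed
  have vu12: "norm (fst (v t x) - fst (u x)) \<le> 1/8" "norm (snd (v t x) - snd (u x)) \<le> 1/8"
    if "t \<in> {0..1}" "x \<in> ?S" for t x
    using vu[OF that] norm_fst_snd_le(1)[of "v t x - u x"] norm_fst_snd_le(2)[of "v t x - u x"] by auto
  have nz: "fst (v t x) \<noteq> 0" "snd (v t x) \<noteq> 0" if "t \<in> {0..1}" "x \<in> ?S" for t x
    using vu12[OF that] uS[OF that(2)] by auto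
  have contv: "continuous_on ({0..1} \<times> ?S) (\<lambda>z. v (fst z) (snd z))"
    unfolding v_def \<mu>_def
    by (intro continuous_intros continuous_on_compose2[OF u(1)] continuous_on_compose2[OF contP]) auto
  have contK: "continuous_on ({0..1} \<times> ?S) K"
    unfolding K_def using nz by (intro continuous_intros contv) auto
  have KS: "K \<in> {0..1} \<times> ?S \<rightarrow> ?S \<times> ?S"
    using nz by (auto simp: K_def)
  define u' where "u' x = K (1, x)" for x
  have hom: "homotopic_with_canon (\<lambda>h. \<forall>x\<in>{x\<in>?S. u x = (p, p)}. h x = (p, p)) ?S (?S \<times> ?S) u u'"
  proof (rule homotopic_with_constI[OF contK KS])
    show "K (0, x) = u x" if "x \<in> ?S" for x
      using uS[OF that] by (simp add: K_def v_def)
    show "K (t, x) = (p, p)" if "x \<in> {x \<in> ?S. u x = (p, p)}" for t x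
      using that p by (simp add: K_def v_def \<mu>_def)
  qed (auto simp: u'_def)
  \<comment> \<open>Normalisation forgets the lengths of the two coordinates, and two real
    parameters restore them. So the range of \<open>g\<close> contains every point whose two
    directions are those of some \<open>P x\<close>, while the domain has dimension only
    \<open>DIM('b) + 2\<close>.\<close>
  define g where "g = (\<lambda>z::'b \<times> real \<times> real. (fst (snd z) *\<^sub>R fst (P (fst z)), snd (snd z) *\<^sub>R snd (P (fst z))))"
  have "\<forall>x. \<exists>D. (P has_derivative D) (at x)"
    using differentiable_at_polynomial_function[OF P(1)] unfolding differentiable_def by blast
  then obtain P' where P': "\<And>x. (P has_derivative P' x) (at x)"
    by metis
  have dP: "((\<lambda>z::'b \<times> real \<times> real. P (fst z)) has_derivative (\<lambda>h. P' (fst z) (fst h))) (at z)" for z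
    by (rule has_derivative_compose[OF has_derivative_fst[OF has_derivative_ident] P'])
  have "g differentiable (at z)" for z
    unfolding g_def differentiable_def
    by (rule exI) (rule has_derivative_Pair has_derivative_scaleR has_derivative_fst has_derivative_snd
        has_derivative_ident dP)+
  then have "g differentiable_on UNIV"
    by (simp add: differentiable_on_def)
  then have "negligible (range g)"
    by (intro negligible_differentiable_image_lowdim) (use dim in simp)
  \<comment> \<open>The missed point is sought near \<open>(- p, - p)\<close> so that both of its
    directions are far from \<open>p\<close>: at distance at least 2 - 1/2.\<close>
  moreover have "\<not> negligible (ball (- p, - p) (1/4))"
    by (intro open_not_negligible) auto
  ultimately have "\<not> ball (- p, - p) (1/4) \<subseteq> range g"
    using negligible_subset by blast
  then obtain e where e: "e \<in> ball (- p, - p) (1/4)" "e \<notin> range g"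
    by blast
  have e12: "norm (fst e - - p) \<le> 1/4" "norm (snd e - - p) \<le> 1/4"
    using e(1) norm_fst_snd_le(1)[of "e - (- p, - p)"] norm_fst_snd_le(2)[of "e - (- p, - p)"]
    by (auto simp: dist_norm norm_minus_commute)
  have enz: "fst e \<noteq> 0" "snd e \<noteq> 0"
    using e12 p by auto
  have far: "norm (nrmlz w - p) \<ge> 3/2" if "norm (w - - p) \<le> 1/4" "w \<noteq> 0" for w
  proof -
    have "norm (nrmlz w - - p) \<le> 1/2"
      using norm_nrmlz_diff[of "- p" w] that p by simp
    moreover have "norm (2 *\<^sub>R p) \<le> norm (nrmlz w - - p) + norm (nrmlz w - p)"
      using norm_triangle_ineq4[of "nrmlz w - - p" "nrmlz w - p"] by (simp add: scaleR_2)
    ultimately show ?thesis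
      using p by simp
  qed
  note far1 = far[OF e12(1) enz(1)] and far2 = far[OF e12(2) enz(2)]
  have "(nrmlz (fst e), nrmlz (snd e)) \<notin> u' ` ?S"
  proof
    assume "(nrmlz (fst e), nrmlz (snd e)) \<in> u' ` ?S"
    then obtain x where x: "x \<in> ?S" "nrmlz (fst e) = nrmlz (fst (v 1 x))" "nrmlz (snd e) = nrmlz (snd (v 1 x))"
      by (auto simp: u'_def K_def)
    \<comment> \<open>If the point were hit at \<open>x\<close>, then \<open>u x\<close> would be at
      distance at least 1 from the base point, because 3/2 - 1/4 exceeds 1; there the weight is 1
      and \<open>g\<close> accounts for the value.\<close>
    have "norm (nrmlz (fst e) - fst (u x)) \<le> 1/4"
      using norm_nrmlz_diff[of "fst (u x)" "fst (v 1 x)"] vu12(1)[of 1 x] nz[of 1 x] uS[OF x(1)] x(1,2) by simp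
    with far1 have "1 \<le> norm (fst (u x) - p)"
      using norm_triangle_ineq[of "nrmlz (fst e) - fst (u x)" "fst (u x) - p"] by simp
    also have "\<dots> \<le> norm (u x - (p, p))"
      using norm_fst_snd_le(1)[of "u x - (p, p)"] by simp
    finally have "\<mu> x = 1"
      by (simp add: \<mu>_def)
    then have "v 1 x = P x"
      by (simp add: v_def)
    then have "fst e = (norm (fst e) / norm (fst (P x))) *\<^sub>R fst (P x)"
      "snd e = (norm (snd e) / norm (snd (P x))) *\<^sub>R snd (P x)"
      using x(2,3) nrmlz_scale[of "fst e"] nrmlz_scale[of "snd e"] by (simp_all add: nrmlz_def divide_inverse)
    then have "e = g (x, norm (fst e) / norm (fst (P x)), norm (snd e) / norm (snd (P x)))"
      by (simp add: g_def prod_eq_iff)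
    with e(2) show False by blast
  qed
  moreover have "nrmlz (fst e) \<in> ?S" "nrmlz (snd e) \<in> ?S"
    using enz by auto
  moreover have "nrmlz (fst e) \<noteq> p" "nrmlz (snd e) \<noteq> p"
    using far1 far2 by auto
  ultimately show ?thesis
    by (intro that[OF hom])
qed

text \<open>When \<open>(d1, d2)\<close> is missed, at every \<open>x\<close> at least one
  coordinate stays away from its \<open>d\<close>. Expanding the two spheres from \<open>d1\<close>
  and \<open>d2\<close> until everything away from them reaches \<open>p\<close> brings the image
  into the axes.\<close>

lemma homotopic_into_axes:
  fixes p :: "'b::euclidean_space"
  assumes dim: "DIM('b) \<ge> 3" and p: "p \<in> sphere 0 1"
    and u: "continuous_on (sphere 0 1) u" "u \<in> sphere (0::'b) 1 \<rightarrow> sphere 0 1 \<times> sphere 0 1"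
  obtains u'' where
    "homotopic_with_canon (\<lambda>h. \<forall>x\<in>{x\<in>sphere 0 1. u x = (p, p)}. h x = (p, p))
       (sphere 0 1) (sphere 0 1 \<times> sphere 0 1) u u''"
    "\<And>x. x \<in> sphere 0 1 \<Longrightarrow> fst (u'' x) = p \<or> snd (u'' x) = p"
proof -
  let ?S = "sphere (0::'b) 1"
  let ?Z = "{x\<in>?S. u x = (p, p)}"
  obtain u' d1 d2 where u': "homotopic_with_canon (\<lambda>h. \<forall>x\<in>?Z. h x = (p, p)) ?S (?S \<times> ?S) u u'"
    and d: "d1 \<in> ?S" "d2 \<in> ?S" "d1 \<noteq> p" "d2 \<noteq> p" "(d1, d2) \<notin> u' ` ?S"
    by (rule homotopic_missing_point[OF dim p u])
  have contu': "continuous_on ?S u'"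
    using homotopic_with_imp_continuous[OF u'] by blast
  have u'S: "u' \<in> ?S \<rightarrow> ?S \<times> ?S"
    by (rule homotopic_with_imp_funspace2[OF u'])
  have u'Z: "u' x = (p, p)" if "x \<in> ?Z" for x
    using homotopic_with_imp_property[OF u'] that by blast
  have "compact (u' ` ?S)"
    by (intro compact_continuous_image contu' compact_sphere)
  then obtain \<delta> where \<delta>: "\<delta> > 0" "\<And>z. z \<in> u' ` ?S \<Longrightarrow> \<delta> \<le> dist (d1, d2) z"
    using separate_point_closed[OF compact_imp_closed d(5)] by blast
  \<comment> \<open>Half of \<delta> suffices: two coordinate distances below it add up to less than
    \<delta>. The point \<open>p\<close> is inserted because it may lie that close to
    \<open>d\<close> and yet has to stay fixed.\<close>
  define K where "K d = insert p {x \<in> ?S. \<delta>/2 \<le> dist x d}" for d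
  have K: "closed (K d)" "K d \<subseteq> ?S" "p \<in> K d" for d
  proof -
    have "{x \<in> ?S. \<delta>/2 \<le> dist x d} = ?S \<inter> {x. \<delta>/2 \<le> dist x d}"
      by auto
    then show "closed (K d)"
      unfolding K_def
      by (simp only:) (intro closed_insert closed_Int closed_Collect_le continuous_intros closed_sphere)
  qed (use p in \<open>auto simp: K_def\<close>)
  have dK: "d1 \<notin> K d1" "d2 \<notin> K d2"
    using d \<delta>(1) by (auto simp: K_def)
  obtain E1 :: "real \<times> 'b \<Rightarrow> 'b" where E1: "continuous_on ({0..1} \<times> ?S) E1" "E1 \<in> {0..1} \<times> ?S \<rightarrow> ?S"
    "\<And>x. x \<in> ?S \<Longrightarrow> E1 (0, x) = x" "\<And>t. t \<in> {0..1} \<Longrightarrow> E1 (t, p) = p" "\<And>x. x \<in> K d1 \<Longrightarrow> E1 (1, x) = p"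
    using sphere_expand[OF d(1) K(1,2) dK(1) K(3)] by blast
  obtain E2 :: "real \<times> 'b \<Rightarrow> 'b" where E2: "continuous_on ({0..1} \<times> ?S) E2" "E2 \<in> {0..1} \<times> ?S \<rightarrow> ?S"
    "\<And>x. x \<in> ?S \<Longrightarrow> E2 (0, x) = x" "\<And>t. t \<in> {0..1} \<Longrightarrow> E2 (t, p) = p" "\<And>x. x \<in> K d2 \<Longrightarrow> E2 (1, x) = p"
    using sphere_expand[OF d(2) K(1,2) dK(2) K(3)] by blast
  have u'12: "fst (u' x) \<in> ?S" "snd (u' x) \<in> ?S" if "x \<in> ?S" for x
    using u'S that by (auto simp: Pi_iff mem_Times_iff)
  define H where "H z = (E1 (fst z, fst (u' (snd z))), E2 (fst z, snd (u' (snd z))))" for z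
  have cu: "continuous_on ({0..1::real} \<times> ?S) (\<lambda>z. u' (snd z))"
    by (intro continuous_on_compose2[OF contu'] continuous_intros) auto
  have contH: "continuous_on ({0..1} \<times> ?S) H"
    unfolding H_def
    by (intro continuous_intros continuous_on_compose2[OF E1(1)] continuous_on_compose2[OF E2(1)] cu)
      (use u'12 in auto)
  have HS: "H \<in> {0..1} \<times> ?S \<rightarrow> ?S \<times> ?S"
  proof
    fix z assume "z \<in> {0..1::real} \<times> ?S"
    then have "(fst z, fst (u' (snd z))) \<in> {0..1} \<times> ?S" "(fst z, snd (u' (snd z))) \<in> {0..1} \<times> ?S"
      using u'12 by auto
    then show "H z \<in> ?S \<times> ?S"
      unfolding H_def using E1(2) E2(2) by blast
  qed
  have "homotopic_with_canon (\<lambda>h. \<forall>x\<in>?Z. h x = (p, p)) ?S (?S \<times> ?S) u' (\<lambda>x. H (1, x))"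
    by (rule homotopic_with_constI[OF contH HS])
      (use u'12 E1(3,4) E2(3,4) u'Z in \<open>auto simp: H_def\<close>)
  from homotopic_with_trans[OF u' this] show ?thesis
  proof (rule that)
    fix x assume x: "x \<in> ?S"
    have "fst (u' x) \<in> K d1 \<or> snd (u' x) \<in> K d2"
    proof (rule ccontr)
      assume "\<not> ?thesis"
      then have "dist (fst (u' x)) d1 < \<delta>/2" "dist (snd (u' x)) d2 < \<delta>/2"
        using u'12[OF x] by (auto simp: K_def)
      moreover have "dist (d1, d2) (u' x) \<le> dist d1 (fst (u' x)) + dist d2 (snd (u' x))"
        unfolding dist_prod_def by (simp add: sqrt_sum_squares_le_sum)
      ultimately show False
        using \<delta>(2)[of "u' x"] x by (simp add: dist_commute)
    qed
    then show "fst (H (1, x)) = p \<or> snd (H (1, x)) = p"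
      using E1(5) E2(5) by (auto simp: H_def)
  qed
qed

subsection \<open>An essential map of the product onto a sphere that collapses the axes\<close>

text \<open>This presents the unit sphere of a subspace as a relative frontier, the form in which
  the results on ANRs and on maps between spheres apply.\<close>

lemma rel_frontier_cball_Int_subspace:
  fixes V :: "'a::euclidean_space set"
  assumes "subspace V"
  shows "rel_frontier (cball 0 1 \<inter> V) = sphere 0 1 \<inter> V"
    and "aff_dim (cball 0 1 \<inter> V) = int (dim V)"
proof -
  have 0: "0 \<in> interior (cball (0::'a) 1) \<inter> V"
    using subspace_0[OF assms] by simp
  then show "rel_frontier (cball 0 1 \<inter> V) = sphere 0 1 \<inter> V"
    using convex_affine_rel_frontier_Int[OF convex_cball subspace_imp_affine[OF assms]] by (metis empty_iff frontier_cball)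
  have "aff_dim (V \<inter> cball 0 1) = aff_dim V"
    using 0 by (intro aff_dim_convex_Int_nonempty_interior subspace_imp_convex assms) auto
  then show "aff_dim (cball 0 1 \<inter> V) = int (dim V)"
    by (simp add: Int_commute aff_dim_subspace assms)
qed

text \<open>The product is embedded as the boundary of a tubular neighbourhood of the sphere of
  radius 2 in the hyperplane \<open>V\<close>; \<open>\<beta>\<close> is the direction as seen from the point \<open>(2p, 0)\<close> inside it.\<close>
context
  fixes p :: "'b::euclidean_space"
  assumes p: "norm p = 1"
begin

text \<open>For \<open>DIM('b) = n + 1\<close> this hyperplane has dimension 2n + 1, so
  \<open>unit_hyp\<close> is a sphere of dimension 2n.\<close>

definition hyp :: "('b \<times> 'b) set" where
  "hyp = {z. snd z \<bullet> p = 0}"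

definition unit_hyp :: "('b \<times> 'b) set" where
  "unit_hyp = sphere 0 1 \<inter> hyp"

text \<open>For \<open>DIM('b) = 2\<close> this is the torus of revolution with radii 2 and 1: the
  component of \<open>snd z\<close> along \<open>p\<close> becomes a radial displacement, the rest
  is kept as second coordinate.\<close>

definition tube :: "'b \<times> 'b \<Rightarrow> 'b \<times> 'b" where
  "tube z = ((2 + snd z \<bullet> p) *\<^sub>R fst z, snd z - (snd z \<bullet> p) *\<^sub>R p)"

definition tube_dir :: "'b \<times> 'b \<Rightarrow> 'b \<times> 'b" where
  "tube_dir z = nrmlz (tube z - (2 *\<^sub>R p, 0))"

lemma pp: "p \<bullet> p = 1"
  using p by (simp add: norm_eq_1)

lemma subspace_hyp: "subspace hyp" and dim_hyp: "dim hyp = 2 * DIM('b) - 1"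
proof -
  have eq: "hyp = {z. (0, p) \<bullet> z = 0}"
    by (auto simp: hyp_def inner_prod_def inner_commute)
  show "subspace hyp"
    unfolding eq by (rule subspace_hyperplane)
  have "(0::'b, p) \<noteq> 0"
    using p by (auto simp: zero_prod_def)
  from dim_hyperplane[OF this] show "dim hyp = 2 * DIM('b) - 1"
    unfolding eq by simp
qed

lemma ANR_unit_hyp: "ANR unit_hyp"
  using ANR_rel_frontier_convex[of "cball 0 1 \<inter> hyp"] subspace_hyp
  by (simp add: unit_hyp_def rel_frontier_cball_Int_subspace bounded_Int convex_Int subspace_imp_convex)

text \<open>The target sphere has the larger dimension, since
  \<open>DIM('b) - 1 < 2 * DIM('b) - 2\<close>.\<close>

lemma inessential_unit_hyp:
  fixes m :: "'b \<Rightarrow> 'b \<times> 'b"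
  assumes "DIM('b) \<ge> 2" "continuous_on (sphere 0 1) m" "m \<in> sphere 0 1 \<rightarrow> unit_hyp"
  shows "\<exists>a. homotopic_with_canon (\<lambda>h. True) (sphere 0 1) unit_hyp m (\<lambda>_. a)"
proof -
  have S: "rel_frontier (cball (0::'b) 1) = sphere 0 1"
    by simp
  have Y: "rel_frontier (cball 0 1 \<inter> hyp) = unit_hyp"
    by (simp add: unit_hyp_def rel_frontier_cball_Int_subspace subspace_hyp)
  have "aff_dim (cball (0::'b) 1) < aff_dim (cball 0 1 \<inter> hyp)"
    using assms(1) by (simp add: rel_frontier_cball_Int_subspace(2)[OF subspace_hyp] dim_hyp aff_dim_cball)
  then obtain a where "homotopic_with_canon (\<lambda>h. True) (rel_frontier (cball (0::'b) 1))
      (rel_frontier (cball 0 1 \<inter> hyp)) m (\<lambda>_. a)"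
    using inessential_spheremap_lowdim_gen[of "cball (0::'b) 1" "cball 0 1 \<inter> hyp" m] assms(2,3) S Y
    by (metis bounded_Int bounded_cball convex_Int convex_cball subspace_hyp subspace_imp_convex)
  then show ?thesis
    unfolding S Y by blast
qed

lemma inner_p_le: "x \<in> sphere 0 1 \<Longrightarrow> \<bar>x \<bullet> p\<bar> \<le> 1"
  using Cauchy_Schwarz_ineq2[of x p] p by simp

text \<open>Equality in the first coordinate forces the radial displacement to vanish, and then the
  second coordinate forces \<open>snd z = 0\<close>.\<close>

lemma tube_ne:
  assumes "z \<in> sphere 0 1 \<times> sphere 0 1"
  shows "tube z - (2 *\<^sub>R p, 0) \<noteq> 0"
proof
  assume "tube z - (2 *\<^sub>R p, 0) = 0"
  then have 1: "(2 + snd z \<bullet> p) *\<^sub>R fst z = 2 *\<^sub>R p" and 2: "snd z = (snd z \<bullet> p) *\<^sub>R p"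
    by (auto simp: tube_def zero_prod_def)
  have z: "norm (fst z) = 1" "norm (snd z) = 1" "\<bar>snd z \<bullet> p\<bar> \<le> 1"
    using assms inner_p_le[of "snd z"] by auto
  have "norm ((2 + snd z \<bullet> p) *\<^sub>R fst z) = 2"
    unfolding 1 using p by simp
  then have "snd z \<bullet> p = 0"
    using z by simp
  with 2 z(2) show False
    by simp
qed

lemma tube_in_hyp: "tube z \<in> hyp" and centre_in_hyp: "(2 *\<^sub>R p, 0) \<in> hyp"
  by (simp_all add: tube_def hyp_def inner_diff_left pp)

lemma nrmlz_in_unit_hyp: "w \<in> hyp \<Longrightarrow> w \<noteq> 0 \<Longrightarrow> nrmlz w \<in> unit_hyp"
  unfolding unit_hyp_def using subspace_hyp by (auto simp: nrmlz_def subspace_scale)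

lemma tube_dir_in: "z \<in> sphere 0 1 \<times> sphere 0 1 \<Longrightarrow> tube_dir z \<in> unit_hyp"
  unfolding tube_dir_def
  by (intro nrmlz_in_unit_hyp tube_ne subspace_diff[OF subspace_hyp] tube_in_hyp centre_in_hyp)

lemma continuous_on_tube: "continuous_on A tube"
  unfolding tube_def by (intro continuous_intros)

lemma continuous_on_tube_dir: "continuous_on (sphere 0 1 \<times> sphere 0 1) tube_dir"
  unfolding tube_dir_def by (intro continuous_intros continuous_on_tube tube_ne)

text \<open>A no-retraction argument. A null-homotopy would let the direction map extend from the
  tube to all of space with values in \<open>unit_hyp\<close>. Used inside the tube, with the true
  direction from \<open>?a\<close> outside, the extension sends the ball \<open>C\<close> of the
  hyperplane to its boundary sphere. The sign in \<rho> makes this map antipodal on the boundary,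
  against Brouwer's fixed point theorem.\<close>

lemma tube_dir_essential:
  "\<not> homotopic_with_canon (\<lambda>h. True) (sphere 0 1 \<times> sphere 0 1) unit_hyp tube_dir (\<lambda>_. c)"
proof
  let ?S = "sphere (0::'b) 1" and ?a = "(2 *\<^sub>R p, 0::'b)"
  assume null: "homotopic_with_canon (\<lambda>h. True) (?S \<times> ?S) unit_hyp tube_dir (\<lambda>_. c)"
  define T where "T = tube ` (?S \<times> ?S)"
  define k :: "'b \<times> 'b \<Rightarrow> 'b \<times> 'b" where "k z = (nrmlz (fst z), snd z + (norm (fst z) - 2) *\<^sub>R p)" for z
  have norm_tube: "norm (fst (tube z)) = 2 + snd z \<bullet> p" "norm (fst (tube z)) > 0" if "z \<in> ?S \<times> ?S" for z
    using that inner_p_le[of "snd z"] by (auto simp: tube_def)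
  have k: "k (tube z) = z" if "z \<in> ?S \<times> ?S" for z
  proof -
    have "nrmlz (fst (tube z)) = fst z"
      using norm_tube[OF that] by (simp add: nrmlz_def) (simp add: tube_def)
    then show ?thesis
      using norm_tube(1)[OF that] by (simp add: k_def prod_eq_iff) (simp add: tube_def)
  qed
  have "compact T"
    unfolding T_def by (intro compact_continuous_image continuous_on_tube compact_Times compact_sphere)
  then have "closed T"
    by (rule compact_imp_closed)
  have contk: "continuous_on T k"
    unfolding k_def T_def using norm_tube(2) by (intro continuous_intros) auto
  have kT: "k \<in> T \<rightarrow> ?S \<times> ?S"
    unfolding T_def using k by auto
  have hom: "homotopic_with_canon (\<lambda>h. True) T unit_hyp (tube_dir \<circ> k) ((\<lambda>_. c) \<circ> k)"
    by (rule homotopic_with_compose_continuous_right[OF null contk kT])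
  have "T \<noteq> {}"
    using p by (auto simp: T_def)
  have "\<exists>c. homotopic_with_canon (\<lambda>h. True) T unit_hyp (tube_dir \<circ> k) (\<lambda>_. c)"
    using hom unfolding comp_def by (rule exI)
  then have "\<exists>E. continuous_on UNIV E \<and> range E \<subseteq> unit_hyp \<and> (\<forall>z\<in>T. E z = (tube_dir \<circ> k) z)"
    using nullhomotopic_into_ANR_extension[OF \<open>closed T\<close> conjunct1[OF homotopic_with_imp_continuous[OF hom]]
        ANR_unit_hyp homotopic_with_imp_subset1[OF hom] \<open>T \<noteq> {}\<close>] by (rule_tac iffD1)
  then obtain E where E: "continuous_on UNIV E" "range E \<subseteq> unit_hyp"
      "\<And>z. z \<in> T \<Longrightarrow> E z = tube_dir (k z)"
    by auto
  \<comment> \<open>The squared distance from the core sphere \<open>norm (fst z) = 2\<close>,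
    \<open>snd z = 0\<close>. In the hyperplane the tube is \<open>h z = 1\<close>, and
    \<open>?a\<close> lies inside it.\<close>
  define h :: "'b \<times> 'b \<Rightarrow> real" where "h z = (norm (fst z) - 2)\<^sup>2 + (norm (snd z))\<^sup>2" for z
  have bdry: "E z = nrmlz (z - ?a)" if z: "z \<in> hyp" "h z = 1" for z
  proof -
    have "(norm (fst z) - 2)\<^sup>2 \<le> 1"
      using z(2) zero_le_power2[of "norm (snd z)"] unfolding h_def by linarith
    then have "norm (fst z) \<ge> 1"
      using power2_le_iff_abs_le[of 1 "norm (fst z) - 2"] by simp
    then have nz: "fst z \<noteq> 0"
      by auto
    have kp: "snd (k z) \<bullet> p = norm (fst z) - 2"
      using z(1) by (simp add: k_def hyp_def inner_add_left pp)
    have "snd (k z) \<bullet> snd (k z) = h z"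
      using z(1) unfolding h_def hyp_def k_def power2_norm_eq_inner
      by (simp add: inner_add_left inner_add_right pp inner_commute power2_eq_square)
    then have "norm (snd (k z)) = 1"
      using z(2) by (simp add: norm_eq_1)
    moreover have "norm (fst (k z)) = 1"
      using nz by (simp add: k_def)
    ultimately have kz: "k z \<in> ?S \<times> ?S"
      by (simp add: mem_Times_iff)
    have "tube (k z) = z"
      using nrmlz_scale[of "fst z"] by (simp add: tube_def kp prod_eq_iff) (simp add: k_def)
    with kz have "z \<in> T"
      unfolding T_def by (metis imageI)
    then show ?thesis
      using E(3) \<open>tube (k z) = z\<close> by (simp add: tube_dir_def)
  qed
  \<comment> \<open>Radius 7 exceeds 6, a bound for the distance from \<open>?a\<close> when
    \<open>h z \<le> 1\<close>: at most 3 + 2 in the first coordinate and 1 in the second.\<close>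
  define C where "C = cball ?a 7 \<inter> hyp"
  define \<rho> where "\<rho> z = (if h z \<le> 1 then ?a - 7 *\<^sub>R E z else ?a - 7 *\<^sub>R nrmlz (z - ?a))" for z
  have ha: "h ?a = 0"
    using p by (simp add: h_def)
  have EY: "E z \<in> unit_hyp" for z
    using E(2) by blast
  have rY: "nrmlz (z - ?a) \<in> unit_hyp" if "z \<in> hyp" "h z \<ge> 1" for z
    using that ha by (intro nrmlz_in_unit_hyp subspace_diff[OF subspace_hyp] centre_in_hyp) auto
  have rho_in: "\<exists>y\<in>unit_hyp. \<rho> z = ?a - 7 *\<^sub>R y" if "z \<in> hyp" for z
    using EY rY[OF that] by (cases "h z \<le> 1") (auto simp: \<rho>_def)
  have cont\<rho>: "continuous_on C \<rho>"
    unfolding \<rho>_def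
  proof (rule continuous_on_cases_le)
    show "continuous_on C h"
      unfolding h_def by (intro continuous_intros)
    show "continuous_on {z \<in> C. h z \<le> 1} (\<lambda>z. ?a - 7 *\<^sub>R E z)"
      by (intro continuous_intros continuous_on_subset[OF E(1)]) auto
    show "continuous_on {z \<in> C. 1 \<le> h z} (\<lambda>z. ?a - 7 *\<^sub>R nrmlz (z - ?a))"
      using ha by (intro continuous_intros) auto
    show "?a - 7 *\<^sub>R E z = ?a - 7 *\<^sub>R nrmlz (z - ?a)" if "z \<in> C" "h z = 1" for z
      using that bdry by (simp add: C_def)
  qed
  have \<rho>C: "\<rho> \<in> C \<rightarrow> C"
  proof
    fix z assume "z \<in> C"
    then obtain y where y: "y \<in> unit_hyp" "\<rho> z = ?a - 7 *\<^sub>R y"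
      using rho_in[of z] unfolding C_def by blast
    have "dist ?a (\<rho> z) = 7"
      using y by (simp add: dist_norm unit_hyp_def)
    moreover have "\<rho> z \<in> hyp"
      unfolding y(2) using y(1) by (intro subspace_diff subspace_scale subspace_hyp centre_in_hyp)
        (simp add: unit_hyp_def)
    ultimately show "\<rho> z \<in> C"
      by (simp add: C_def)
  qed
  have "?a \<in> C"
    unfolding C_def using centre_in_hyp by simp
  have C: "compact C" "convex C"
    using centre_in_hyp closed_subspace[OF subspace_hyp] subspace_imp_convex[OF subspace_hyp]
    by (auto simp: C_def compact_Int_closed intro: convex_Int)
  \<comment> \<open>The values of \<rho> are at distance 7 from \<open>?a\<close>, so the fixed
    point lies outside the tube, where \<rho> moves it to the opposite side of
    \<open>?a\<close>.\<close>
  obtain z where z: "z \<in> C" "\<rho> z = z"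
    by (rule brouwer[OF C _ cont\<rho> \<rho>C]) (use \<open>?a \<in> C\<close> in auto)
  moreover have "z \<in> hyp"
    using z(1) by (simp add: C_def)
  ultimately obtain y where y: "y \<in> unit_hyp" "z = ?a - 7 *\<^sub>R y"
    using rho_in[of z] by metis
  have nza: "norm (z - ?a) = 7"
    using y by (simp add: unit_hyp_def)
  have "\<not> h z \<le> 1"
  proof
    assume "h z \<le> 1"
    then have "(norm (fst z) - 2)\<^sup>2 \<le> 1" "(norm (snd z))\<^sup>2 \<le> 1"
      unfolding h_def using zero_le_power2[of "norm (fst z) - 2"] zero_le_power2[of "norm (snd z)"] by linarith+
    then have "norm (fst z) \<le> 3" "norm (snd z) \<le> 1"
      using power2_le_iff_abs_le[of 1 "norm (fst z) - 2"] power2_le_iff_abs_le[of 1 "norm (snd z)"] by simp_all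
    moreover have "norm (z - ?a) \<le> norm (fst z - 2 *\<^sub>R p) + norm (snd z)"
      using norm_Pair_le[of "fst z - 2 *\<^sub>R p" "snd z"] by (simp add: minus_prod_def)
    moreover have "norm (fst z - 2 *\<^sub>R p) \<le> norm (fst z) + 2"
      using norm_triangle_ineq4[of "fst z" "2 *\<^sub>R p"] p by simp
    ultimately show False
      using nza by linarith
  qed
  then have "z = ?a - 7 *\<^sub>R nrmlz (z - ?a)"
    using z(2) unfolding \<rho>_def by presburger
  moreover have "7 *\<^sub>R nrmlz (z - ?a) = z - ?a"
    using nrmlz_scale[of "z - ?a"] nza by (simp only:)
  ultimately have "z = ?a - (z - ?a)"
    by (simp only:)
  moreover have "z = ?a" if "z = ?a - (z - ?a)"
  proof -
    from that have "2 *\<^sub>R z = 2 *\<^sub>R ?a"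
      by (metis diff_add_cancel diff_diff_eq2 scaleR_2)
    then show ?thesis
      by (simp only: scaleR_cancel_left) simp
  qed
  ultimately have "z = ?a"
    by blast
  then show False
    using nza by simp
qed

end

section \<open>From the direction map to a map constant on half-spheres\<close>

text \<open>Over \<open>Q\<close>, where one coordinate lies in the half-sphere away from
  \<open>p\<close>, the first coordinate of the direction has nonpositive component along
  \<open>p\<close>. So normalised segments from the direction to \<open>(- p, 0)\<close> never meet
  0 and give a homotopy to that constant. Borsuk's theorem extends it to a homotopy from
  \<open>tube_dir\<close> to \<pi>, which therefore remains essential.\<close>

lemma exists_collapse_map:
  fixes p :: "'b::euclidean_space"
  assumes dim: "DIM('b) \<ge> 2" and p: "p \<in> sphere 0 1"
  obtains \<pi> :: "'b \<times> 'b \<Rightarrow> 'b \<times> 'b" and Y c where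
    "ANR Y" "continuous_on (sphere 0 1 \<times> sphere 0 1) \<pi>" "\<pi> \<in> sphere 0 1 \<times> sphere 0 1 \<rightarrow> Y"
    "\<And>x y. x \<in> sphere 0 1 \<Longrightarrow> y \<in> sphere 0 1 \<Longrightarrow> x \<bullet> p \<le> 0 \<or> y \<bullet> p \<le> 0 \<Longrightarrow> \<pi> (x, y) = c"
    "\<And>a. \<not> homotopic_with_canon (\<lambda>h. True) (sphere 0 1 \<times> sphere 0 1) Y \<pi> (\<lambda>_. a)"
    "\<And>m :: 'b \<Rightarrow> 'b \<times> 'b. continuous_on (sphere 0 1) m \<Longrightarrow> m \<in> sphere 0 1 \<rightarrow> Y \<Longrightarrow>
       \<exists>a. homotopic_with_canon (\<lambda>h. True) (sphere 0 1) Y m (\<lambda>_. a)"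
proof -
  let ?S = "sphere (0::'b) 1"
  have np: "norm p = 1"
    using p by simp
  let ?Y = "unit_hyp p" and ?\<beta> = "tube_dir p" and ?c = "(- p, 0::'b)"
  define Q where "Q = {z \<in> ?S \<times> ?S. fst z \<bullet> p \<le> 0 \<or> snd z \<bullet> p \<le> 0}"
  have cY: "?c \<in> hyp p"
    by (simp add: hyp_def[OF np])
  have \<beta>neg: "fst (?\<beta> z) \<bullet> p \<le> 0" if "z \<in> Q" for z
  proof -
    have z: "\<bar>fst z \<bullet> p\<bar> \<le> 1" "\<bar>snd z \<bullet> p\<bar> \<le> 1"
      using that inner_p_le[OF np, of "fst z"] inner_p_le[OF np, of "snd z"] by (auto simp: Q_def)
    have "(2 + snd z \<bullet> p) * (fst z \<bullet> p) \<le> 2"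
    proof (cases "fst z \<bullet> p \<le> 0")
      case True
      have "(2 + snd z \<bullet> p) * (fst z \<bullet> p) \<le> 0"
        using z True by (intro mult_nonneg_nonpos) auto
      then show ?thesis by simp
    next
      case False
      then have "snd z \<bullet> p \<le> 0"
        using that by (auto simp: Q_def)
      then have "(2 + snd z \<bullet> p) * (fst z \<bullet> p) \<le> 2 * 1"
        using z False by (intro mult_mono) auto
      then show ?thesis by simp
    qed
    then have "fst (tube p z - (2 *\<^sub>R p, 0)) \<bullet> p \<le> 0"
      using pp[OF np] by (simp add: tube_def[OF np] inner_diff_left)
    then show ?thesis
      by (simp add: tube_dir_def[OF np] nrmlz_def mult_nonneg_nonpos)
  qed
  define K where "K w = nrmlz ((1 - fst w) *\<^sub>R ?\<beta> (snd w) + fst w *\<^sub>R ?c)" for w :: "real \<times> 'b \<times> 'b"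
  have QS: "Q \<subseteq> ?S \<times> ?S"
    by (auto simp: Q_def)
  have \<beta>Y: "?\<beta> z \<in> hyp p" "norm (?\<beta> z) = 1" if "z \<in> Q" for z
    using tube_dir_in[OF np, of z] that QS by (auto simp: unit_hyp_def[OF np])
  have ne: "(1 - t) *\<^sub>R ?\<beta> z + t *\<^sub>R ?c \<noteq> 0" if "t \<in> {0..1}" "z \<in> Q" for t z
  proof
    assume eq0: "(1 - t) *\<^sub>R ?\<beta> z + t *\<^sub>R ?c = 0"
    then have "fst ((1 - t) *\<^sub>R ?\<beta> z + t *\<^sub>R ?c) \<bullet> p = 0"
      by simp
    then have "(1 - t) * (fst (?\<beta> z) \<bullet> p) = t"
      using pp[OF np] by (simp add: inner_add_left inner_diff_left)
    moreover have "(1 - t) * (fst (?\<beta> z) \<bullet> p) \<le> 0"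
      using \<beta>neg[OF that(2)] that(1) by (intro mult_nonneg_nonpos) auto
    ultimately have "t = 0"
      using that(1) by simp
    with eq0 \<beta>Y(2)[OF that(2)] show False
      by (auto simp: zero_prod_def)
  qed
  have cont\<beta>: "continuous_on ({0..1::real} \<times> Q) (\<lambda>w. ?\<beta> (snd w))"
    using QS by (intro continuous_on_compose2[OF continuous_on_tube_dir[OF np]] continuous_intros) auto
  have homQ: "homotopic_with_canon (\<lambda>h. True) Q ?Y ?\<beta> (\<lambda>_. ?c)"
  proof (rule homotopic_with_canonI)
    show "continuous_on ({0..1} \<times> Q) K"
      unfolding K_def by (intro continuous_intros cont\<beta>) (use ne in auto)
    show "K \<in> {0..1} \<times> Q \<rightarrow> ?Y"
    proof
      fix w assume "w \<in> {0..1::real} \<times> Q"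
      then show "K w \<in> ?Y"
        unfolding K_def using ne[of "fst w" "snd w"] \<beta>Y cY subspace_hyp[OF np]
        by (intro nrmlz_in_unit_hyp[OF np] subspace_add subspace_scale) auto
    qed
    show "K (0, z) = ?\<beta> z" "K (1, z) = ?c" if "z \<in> Q" for z
      using \<beta>Y(2)[OF that] np by (simp_all add: K_def norm_Pair flip: zero_prod_def)
  qed
  have cloQ: "closedin (top_of_set (?S \<times> ?S)) Q"
  proof -
    have "Q = (?S \<times> ?S) \<inter> ({z. fst z \<bullet> p \<le> 0} \<union> {z. snd z \<bullet> p \<le> 0})"
      by (auto simp: Q_def)
    then show ?thesis
      by (simp only:) (intro closedin_closed_Int closed_Un closed_Collect_le continuous_intros)
  qed
  have \<beta>im: "?\<beta> \<in> ?S \<times> ?S \<rightarrow> ?Y"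
    using tube_dir_in[OF np] by blast
  obtain \<pi> where \<pi>: "homotopic_with_canon (\<lambda>h. True) (?S \<times> ?S) ?Y ?\<beta> \<pi>"
      "continuous_on (?S \<times> ?S) \<pi>" "\<pi> ` (?S \<times> ?S) \<subseteq> ?Y" "\<And>z. z \<in> Q \<Longrightarrow> \<pi> z = ?c"
    by (rule Borsuk_homotopy_extension_homotopic[OF cloQ disjI2[OF ANR_unit_hyp[OF np]]
          continuous_on_tube_dir[OF np] \<beta>im homQ]) (rule that; assumption)
  show ?thesis
  proof (rule that[OF ANR_unit_hyp[OF np] \<pi>(2)])
    show "\<pi> \<in> ?S \<times> ?S \<rightarrow> ?Y"
      using \<pi>(3) by blast
    show "\<pi> (x, y) = ?c" if "x \<in> ?S" "y \<in> ?S" "x \<bullet> p \<le> 0 \<or> y \<bullet> p \<le> 0" for x y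
      using \<pi>(4) that by (simp add: Q_def)
    show "\<not> homotopic_with_canon (\<lambda>h. True) (?S \<times> ?S) ?Y \<pi> (\<lambda>_. a)" for a
      using tube_dir_essential[OF np] homotopic_with_trans[OF \<pi>(1)] by blast
    show "\<exists>a. homotopic_with_canon (\<lambda>h. True) ?S ?Y m (\<lambda>_. a)"
      if "continuous_on ?S m" "m \<in> ?S \<rightarrow> ?Y" for m
      using inessential_unit_hyp[OF np dim that] .
  qed
qed

subsection \<open>Null-homotopies of the collapsing map\<close>

locale collapse_map =
  fixes p :: "'b::euclidean_space" and \<pi> :: "'b \<times> 'b \<Rightarrow> 'b \<times> 'b" and Y c
  assumes dim: "DIM('b) \<ge> 3" and p: "p \<in> sphere 0 1"
    and ANR_Y: "ANR Y"
    and cont_\<pi>: "continuous_on (sphere 0 1 \<times> sphere 0 1) \<pi>"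
    and \<pi>_in: "\<pi> \<in> sphere 0 1 \<times> sphere 0 1 \<rightarrow> Y"
    and \<pi>_c: "\<And>x y. x \<in> sphere 0 1 \<Longrightarrow> y \<in> sphere 0 1 \<Longrightarrow> x \<bullet> p \<le> 0 \<or> y \<bullet> p \<le> 0 \<Longrightarrow> \<pi> (x, y) = c"
begin

abbreviation S :: "'b set" where "S \<equiv> sphere 0 1"

definition null :: "('b \<times> 'b \<Rightarrow> 'b \<times> 'b) \<Rightarrow> bool" where
  "null f \<longleftrightarrow> (\<exists>a. homotopic_with_canon (\<lambda>h. True) (S \<times> S) Y f (\<lambda>_. a))"

lemma pp1: "p \<bullet> p = 1"
  using p by (simp add: norm_eq_1)

lemma minus_p: "- p \<in> S" "- p \<bullet> p \<le> 0"
  using p pp1 by auto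

lemma c_in: "c \<in> Y"
  using \<pi>_c[of "- p" p] \<pi>_in minus_p p by fastforce

lemma \<pi>_base: "y \<in> S \<Longrightarrow> \<pi> (- p, y) = c"
  using \<pi>_c[of "- p" y] minus_p by simp

lemma null_homotopic: "homotopic_with_canon (\<lambda>h. True) (S \<times> S) Y f g \<Longrightarrow> null f \<longleftrightarrow> null g"
  unfolding null_def using homotopic_with_trans homotopic_with_symD by meson

text \<open>On the half-sphere \<open>y \<bullet> p \<le> 0\<close> the value is \<open>c\<close>
  whatever the first argument of \<pi>. On the other half, \<open>y\<close> is slid to
  \<open>p\<close> by \<open>s\<close> inside \<phi> alone, while the second argument of \<pi> is
  kept; on the equator both rules give \<open>c\<close>.\<close>

lemma null_axis:
  assumes \<phi>: "continuous_on (S \<times> S) \<phi>" "\<phi> \<in> S \<times> S \<rightarrow> S"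
    and null: "null (\<lambda>z. \<pi> (\<phi> z, snd z))"
  shows "null (\<lambda>z. \<pi> (\<phi> (fst z, p), snd z))"
proof -
  define s where "s t y = nrmlz ((1 - t) *\<^sub>R y + t *\<^sub>R p)" for t y
  define G where "G w = (if snd (snd w) \<bullet> p \<le> 0 then c
      else \<pi> (\<phi> (fst (snd w), s (fst w) (snd (snd w))), snd (snd w)))" for w :: "real \<times> 'b \<times> 'b"
  have ne: "(1 - t) *\<^sub>R y + t *\<^sub>R p \<noteq> 0" if "t \<in> {0..1}" "y \<in> S" "y \<bullet> p \<ge> 0" for t y
  proof
    assume eq0: "(1 - t) *\<^sub>R y + t *\<^sub>R p = 0"
    then have "((1 - t) *\<^sub>R y + t *\<^sub>R p) \<bullet> p = 0"
      by simp
    then have "(1 - t) * (y \<bullet> p) + t = 0"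
      by (simp add: inner_add_left pp1)
    moreover have "(1 - t) * (y \<bullet> p) \<ge> 0"
      using that by simp
    ultimately have "t = 0"
      using that(1) by auto
    with eq0 that(2) show False
      by auto
  qed
  have sS: "s t y \<in> S" if "t \<in> {0..1}" "y \<in> S" "y \<bullet> p \<ge> 0" for t y
    using ne[OF that] by (simp add: s_def)
  let ?D = "{0..1} \<times> (S \<times> S) :: (real \<times> 'b \<times> 'b) set"
  let ?P = "{w \<in> ?D. 0 \<le> snd (snd w) \<bullet> p}"
  have cs: "continuous_on ?P (\<lambda>w. s (fst w) (snd (snd w)))"
    unfolding s_def
  proof (intro continuous_intros)
    show "(1 - fst w) *\<^sub>R snd (snd w) + fst w *\<^sub>R p \<noteq> 0" if "w \<in> ?P" for w
      using ne[of "fst w" "snd (snd w)"] that by auto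
  qed
  have sP: "s (fst w) (snd (snd w)) \<in> S" if "w \<in> ?P" for w
    using sS[of "fst w" "snd (snd w)"] that by auto
  have c\<phi>: "continuous_on ?P (\<lambda>w. \<phi> (fst (snd w), s (fst w) (snd (snd w))))"
  proof (rule continuous_on_compose2[OF \<phi>(1)])
    show "continuous_on ?P (\<lambda>w. (fst (snd w), s (fst w) (snd (snd w))))"
      by (intro continuous_intros cs)
  qed (use sP in auto)
  have \<phi>P: "\<phi> (fst (snd w), s (fst w) (snd (snd w))) \<in> S" if "w \<in> ?P" for w
    using \<phi>(2) sP[OF that] that by (auto simp: Pi_iff)
  have contG: "continuous_on ?D G"
    unfolding G_def
  proof (rule continuous_on_cases_le)
    show "continuous_on ?D (\<lambda>w. snd (snd w) \<bullet> p)"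
      by (intro continuous_intros)
    show "continuous_on ?P (\<lambda>w. \<pi> (\<phi> (fst (snd w), s (fst w) (snd (snd w))), snd (snd w)))"
    proof (rule continuous_on_compose2[OF cont_\<pi>])
      show "continuous_on ?P (\<lambda>w. (\<phi> (fst (snd w), s (fst w) (snd (snd w))), snd (snd w)))"
        by (intro continuous_intros c\<phi>)
    qed (use \<phi>P in auto)
    show "c = \<pi> (\<phi> (fst (snd w), s (fst w) (snd (snd w))), snd (snd w))"
      if "w \<in> ?D" "snd (snd w) \<bullet> p = 0" for w
      using \<pi>_c[OF \<phi>P[of w], of "snd (snd w)"] that by auto
  qed simp
  have "homotopic_with_canon (\<lambda>h. True) (S \<times> S) Y (\<lambda>z. \<pi> (\<phi> z, snd z)) (\<lambda>z. \<pi> (\<phi> (fst z, p), snd z))"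
  proof (rule homotopic_with_canonI[OF contG])
    show "G \<in> ?D \<rightarrow> Y"
    proof
      fix w assume w: "w \<in> ?D"
      show "G w \<in> Y"
      proof (cases "snd (snd w) \<bullet> p \<le> 0")
        case False
        then have "(\<phi> (fst (snd w), s (fst w) (snd (snd w))), snd (snd w)) \<in> S \<times> S"
          using w \<phi>P[of w] by auto
        then show ?thesis
          using funcset_mem[OF \<pi>_in] False by (simp add: G_def)
      qed (simp add: G_def c_in)
    qed
    fix z assume z: "z \<in> S \<times> S"
    have "\<phi> z \<in> S" "\<phi> (fst z, p) \<in> S"
      using \<phi>(2) z p by (auto simp: Pi_iff)
    then show "G (0, z) = \<pi> (\<phi> z, snd z)" "G (1, z) = \<pi> (\<phi> (fst z, p), snd z)"
      using z p \<pi>_c[of "\<phi> z" "snd z"] \<pi>_c[of "\<phi> (fst z, p)" "snd z"] by (auto simp: G_def s_def)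
  qed
  then show ?thesis
    using null null_homotopic by blast
qed

text \<open>If \<open>K\<close> is a null-homotopy, follow it and then run \<open>K (t, (p, y))\<close> backwards: over
  \<open>x = p\<close> this is a path followed by its inverse, which contracts with fixed ends, and the
  contraction extends by Borsuk's theorem.\<close>
lemma null_rel:
  assumes \<alpha>: "continuous_on S \<alpha>" "\<alpha> \<in> S \<rightarrow> S" "\<alpha> p = - p"
    and null: "null (\<lambda>z. \<pi> (\<alpha> (fst z), snd z))"
  shows "homotopic_with_canon (\<lambda>h. \<forall>z\<in>{p} \<times> S. h z = c) (S \<times> S) Y
    (\<lambda>z. \<pi> (\<alpha> (fst z), snd z)) (\<lambda>_. c)"
proof -
  let ?f = "\<lambda>z. \<pi> (\<alpha> (fst z), snd z)"
  obtain a where "homotopic_with_canon (\<lambda>h. True) (S \<times> S) Y ?f (\<lambda>_. a)"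
    using null unfolding null_def by blast
  then obtain K :: "real \<times> 'b \<times> 'b \<Rightarrow> 'b \<times> 'b" where K: "continuous_on ({0..1} \<times> (S \<times> S)) K"
      "K \<in> {0..1} \<times> (S \<times> S) \<rightarrow> Y" "\<And>z. K (0, z) = ?f z" "\<And>z. K (1, z) = a"
    by (rule homotopic_with_canonE) (rule that; assumption)
  let ?D = "{0..1} \<times> (S \<times> S) :: (real \<times> 'b \<times> 'b) set"
  have fp: "?f (p, y) = c" if "y \<in> S" for y
    using that \<alpha>(3) \<pi>_base by simp
  \<comment> \<open>At half time the map is constantly \<open>a\<close>, so the way back may use
    \<open>(p, y)\<close> for every \<open>x\<close>.\<close>
  define M where "M w = (if fst w \<le> 1/2 then K (2 * fst w, snd w)
      else K (2 - 2 * fst w, (p, snd (snd w))))" for w :: "real \<times> 'b \<times> 'b"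
  \<comment> \<open>A tent function: over \<open>x = p\<close>, \<open>M\<close> at time
    \<open>t\<close> is \<open>K\<close> at time \<open>m t\<close>. Lowering the tent by the factor
    in \<open>R\<close> flattens this loop to the constant \<open>c\<close>.\<close>
  define m where "m t = min (2 * t) (2 - 2 * t)" for t :: real
  define R where "R v = (if fst (snd (snd v)) = p then K ((1 - fst v) * m (fst (snd v)), (p, snd (snd (snd v))))
      else M (snd v))" for v :: "real \<times> real \<times> 'b \<times> 'b"
  define Q1 where "Q1 = {w \<in> ?D. fst (snd w) = p}"
  define Q2 where "Q2 = {w \<in> ?D. fst w = 0 \<or> fst w = 1}"
  have cloQ: "closedin (top_of_set ?D) Q1" "closedin (top_of_set ?D) Q2"
  proof -
    have "Q1 = ?D \<inter> {w. fst (snd w) = p}" "Q2 = ?D \<inter> ({w. fst w = 0} \<union> {w. fst w = 1})"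
      by (auto simp: Q1_def Q2_def)
    then show "closedin (top_of_set ?D) Q1" "closedin (top_of_set ?D) Q2"
      by (simp_all only:) (intro closedin_closed_Int closed_Un closed_Collect_eq continuous_intros)+
  qed
  have m01: "(1 - \<tau>) * m t \<in> {0..1}" if "\<tau> \<in> {0..1}" "t \<in> {0..1}" for \<tau> t
  proof -
    have "m t \<in> {0..1}"
      using that(2) by (auto simp: m_def min_def)
    then show ?thesis
      using that(1) by (auto simp: mult_le_one)
  qed
  have contM: "continuous_on ?D M"
    unfolding M_def
  proof (rule continuous_on_cases_le)
    show "continuous_on {w \<in> ?D. fst w \<le> 1/2} (\<lambda>w. K (2 * fst w, snd w))"
      by (rule continuous_on_compose2[OF K(1)]) (auto intro!: continuous_intros)
    show "continuous_on {w \<in> ?D. 1/2 \<le> fst w} (\<lambda>w. K (2 - 2 * fst w, p, snd (snd w)))"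
      by (rule continuous_on_compose2[OF K(1)]) (use p in \<open>auto intro!: continuous_intros\<close>)
    show "K (2 * fst w, snd w) = K (2 - 2 * fst w, p, snd (snd w))" if "fst w = 1/2" for w
    proof -
      have "2 * fst w = 1" "2 - 2 * fst w = 1"
        using that by auto
      then show ?thesis
        by (simp only: K(4))
    qed
  qed (intro continuous_intros)
  have MY: "M \<in> ?D \<rightarrow> Y"
  proof
    fix w assume w: "w \<in> ?D"
    show "M w \<in> Y"
    proof (cases "fst w \<le> 1/2")
      case True
      then have "(2 * fst w, snd w) \<in> ?D"
        using w by auto
      then show ?thesis
        using K(2) True by (auto simp: M_def)
    next
      case False
      then have "(2 - 2 * fst w, (p, snd (snd w))) \<in> ?D"
        using w p by auto
      then show ?thesis
        using K(2) False by (auto simp: M_def)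
    qed
  qed
  have R1: "R v = K ((1 - fst v) * m (fst (snd v)), (p, snd (snd (snd v))))" if "v \<in> {0..1} \<times> Q1" for v
    using that by (auto simp: R_def Q1_def)
  \<comment> \<open>At both ends the tent has height 0, so there \<open>R\<close> is independent of
    the deformation parameter and the two maps to be joined are preserved.\<close>
  have R2: "R v = M (snd v)" if "v \<in> {0..1} \<times> Q2" for v
    using that by (auto simp: R_def Q2_def m_def M_def K(3))
  have D1: "((1 - fst v) * m (fst (snd v)), (p, snd (snd (snd v)))) \<in> ?D" if "v \<in> {0..1} \<times> Q1" for v
    using that p m01[of "fst v" "fst (snd v)"] by (auto simp: Q1_def)
  have contR: "continuous_on ({0..1} \<times> (Q1 \<union> Q2)) R"
  proof -
    have split: "{0..1::real} \<times> (Q1 \<union> Q2) = {0..1} \<times> Q1 \<union> {0..1} \<times> Q2"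
      by blast
    have "continuous_on ({0..1} \<times> Q1) R"
    proof (rule continuous_on_eq)
      show "continuous_on ({0..1} \<times> Q1) (\<lambda>v. K ((1 - fst v) * m (fst (snd v)), (p, snd (snd (snd v)))))"
        unfolding m_def
        by (rule continuous_on_compose2[OF K(1)])
          (use D1[unfolded m_def] in \<open>auto intro!: continuous_intros\<close>)
    qed (simp add: R1)
    moreover have "continuous_on ({0..1} \<times> Q2) R"
    proof (rule continuous_on_eq)
      show "continuous_on ({0..1::real} \<times> Q2) (\<lambda>v. M (snd v))"
        by (rule continuous_on_compose2[OF contM]) (auto intro!: continuous_intros simp: Q2_def)
    qed (simp add: R2)
    moreover have sub: "Q1 \<union> Q2 \<subseteq> ?D"
      by (auto simp: Q1_def Q2_def)
    have "closedin (top_of_set ({0..1} \<times> (Q1 \<union> Q2))) ({0..1::real} \<times> Q1)"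
      "closedin (top_of_set ({0..1} \<times> (Q1 \<union> Q2))) ({0..1::real} \<times> Q2)"
      by (intro closedin_Times closedin_subset_trans[OF cloQ(1) _ sub] closedin_subset_trans[OF cloQ(2) _ sub]; simp)+
    ultimately show ?thesis
      unfolding split by (intro continuous_on_Un_local)
  qed
  have RY: "R \<in> {0..1} \<times> (Q1 \<union> Q2) \<rightarrow> Y"
  proof
    fix v assume "v \<in> {0..1::real} \<times> (Q1 \<union> Q2)"
    then consider "v \<in> {0..1} \<times> Q1" | "v \<in> {0..1} \<times> Q2" by blast
    then show "R v \<in> Y"
    proof cases
      case 1
      then show ?thesis
        using R1 D1 K(2) by (auto simp: Pi_iff)
    next
      case 2
      then show ?thesis
        using R2 MY by (auto simp: Q2_def Pi_iff)
    qed
  qed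
  have R0: "R (0, w) = M w" if "w \<in> Q1 \<union> Q2" for w
    using that by (auto simp: R_def Q1_def m_def M_def K(3,4) min_def)
  obtain N where N: "continuous_on ({0..1} \<times> ?D) N" "N \<in> {0..1} \<times> ?D \<rightarrow> Y"
    "\<And>w. w \<in> ?D \<Longrightarrow> N (0::real, w) = M w"
    "\<And>t w. t \<in> {0..1} \<Longrightarrow> w \<in> Q1 \<union> Q2 \<Longrightarrow> N (t, w) = R (t, w)"
    by (rule homotopy_extension[OF closedin_Un[OF cloQ] ANR_Y contM MY contR RY R0], assumption)
      (rule that; assumption)
  show ?thesis
  proof (rule homotopic_with_constI)
    show "continuous_on ?D (\<lambda>w. N (1, w))"
      by (rule continuous_on_compose2[OF N(1)]) (auto intro!: continuous_intros)
    show "(\<lambda>w. N (1, w)) \<in> ?D \<rightarrow> Y"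
      using N(2) by auto
    fix z assume z: "z \<in> S \<times> S"
    have "(0, z) \<in> Q2" "(1, z) \<in> Q2"
      using z by (auto simp: Q2_def)
    then have "N (1, (0, z)) = M (0, z)" "N (1, (1, z)) = M (1, z)"
      using N(4)[of 1] R2[of "(1, (0, z))"] R2[of "(1, (1, z))"] by auto
    then show "N (1, (0, z)) = ?f z" "N (1, (1, z)) = c"
      using z fp[of "snd z"] by (auto simp: M_def K(3))
  next
    fix t :: real and z assume "t \<in> {0..1}" "z \<in> {p} \<times> S"
    then have "(t, z) \<in> Q1"
      using p by (auto simp: Q1_def)
    then show "N (1, (t, z)) = c"
      using N(4)[of 1 "(t, z)"] R1[of "(1, (t, z))"] \<open>z \<in> {p} \<times> S\<close> fp[of "snd z"] by (auto simp: K(3))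
  qed (use p in auto)
qed

text \<open>Once \<open>u\<close> is pushed into the axes, \<open>null_rel\<close> contracts each
  axis while keeping \<open>c\<close> over the crossing point, so the two homotopies glue. Keeping
  \<open>c\<close> wherever \<open>u\<close> hits \<open>(p, p)\<close> is what later allows
  different pieces to be combined.\<close>

lemma null_factor:
  assumes \<phi>: "continuous_on (S \<times> S) \<phi>" "\<phi> \<in> S \<times> S \<rightarrow> S" "\<phi> (p, p) = - p"
    and null: "null (\<lambda>z. \<pi> (\<phi> (fst z, p), snd z))" "null (\<lambda>z. \<pi> (\<phi> (p, fst z), snd z))"
    and u: "continuous_on S u" "u \<in> S \<rightarrow> S \<times> S"
  shows "homotopic_with_canon (\<lambda>h. \<forall>z\<in>{x \<in> S. u x = (p, p)} \<times> S. h z = c) (S \<times> S) Y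
    (\<lambda>z. \<pi> (\<phi> (u (fst z)), snd z)) (\<lambda>_. c)"
proof -
  let ?Z = "{x \<in> S. u x = (p, p)}"
  let ?D = "{0..1} \<times> (S \<times> S) :: (real \<times> 'b \<times> 'b) set"
  obtain u' where u': "homotopic_with_canon (\<lambda>h. \<forall>x\<in>?Z. h x = (p, p)) S (S \<times> S) u u'"
      "\<And>x. x \<in> S \<Longrightarrow> fst (u' x) = p \<or> snd (u' x) = p"
    by (rule homotopic_into_axes[OF dim p u]) (rule that; assumption)
  obtain K where K: "continuous_on ({0..1} \<times> S) K" "K \<in> {0..1} \<times> S \<rightarrow> S \<times> S"
      "\<And>x. K (0::real, x) = u x" "\<And>x. K (1, x) = u' x" "\<And>t x. t \<in> {0..1} \<Longrightarrow> x \<in> ?Z \<Longrightarrow> K (t, x) = (p, p)"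
    by (rule homotopic_with_constE[OF u'(1)]) (rule that; assumption)
  have u'S: "u' \<in> S \<rightarrow> S \<times> S" and contu': "continuous_on S u'"
    using homotopic_with_imp_funspace2[OF u'(1)] homotopic_with_imp_continuous[OF u'(1)] by auto
  have u'Z: "u' x = (p, p)" if "x \<in> ?Z" for x
    using K(4)[of x] K(5)[of 1 x] that by simp
  have 1: "homotopic_with_canon (\<lambda>h. \<forall>z\<in>?Z \<times> S. h z = c) (S \<times> S) Y
      (\<lambda>z. \<pi> (\<phi> (u (fst z)), snd z)) (\<lambda>z. \<pi> (\<phi> (u' (fst z)), snd z))"
  proof (rule homotopic_with_constI)
    have KD: "K (fst w, fst (snd w)) \<in> S \<times> S" if "w \<in> ?D" for w
      using K(2) that by (auto simp: Pi_iff)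
    have \<phi>D: "\<phi> (K (fst w, fst (snd w))) \<in> S" if "w \<in> ?D" for w
      by (rule funcset_mem[OF \<phi>(2) KD[OF that]])
    have cK: "continuous_on ?D (\<lambda>w. K (fst w, fst (snd w)))"
      by (rule continuous_on_compose2[OF K(1)]) (auto intro!: continuous_intros)
    have "continuous_on ?D (\<lambda>w. \<phi> (K (fst w, fst (snd w))))"
      by (rule continuous_on_compose2[OF \<phi>(1) cK]) (use KD in blast)
    then show "continuous_on ?D (\<lambda>w. \<pi> (\<phi> (K (fst w, fst (snd w))), snd (snd w)))"
      by (intro continuous_on_compose2[OF cont_\<pi>] continuous_intros) (use \<phi>D in auto)
    show "(\<lambda>w. \<pi> (\<phi> (K (fst w, fst (snd w))), snd (snd w))) \<in> ?D \<rightarrow> Y"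
    proof
      fix w assume w: "w \<in> ?D"
      then have "(\<phi> (K (fst w, fst (snd w))), snd (snd w)) \<in> S \<times> S"
        using \<phi>D[OF w] by auto
      then show "\<pi> (\<phi> (K (fst w, fst (snd w))), snd (snd w)) \<in> Y"
        by (rule funcset_mem[OF \<pi>_in])
    qed
  qed (use K \<phi>(3) \<pi>_base in auto)
  have \<phi>p: "continuous_on S (\<lambda>x. \<phi> (x, p))" "(\<lambda>x. \<phi> (x, p)) \<in> S \<rightarrow> S"
    "continuous_on S (\<lambda>x. \<phi> (p, x))" "(\<lambda>x. \<phi> (p, x)) \<in> S \<rightarrow> S"
    using \<phi>(2) p by (auto intro!: continuous_on_compose2[OF \<phi>(1)] continuous_intros simp: Pi_iff)
  obtain M1 where M1: "continuous_on ?D M1" "M1 \<in> ?D \<rightarrow> Y" "\<And>z. M1 (0, z) = \<pi> (\<phi> (fst z, p), snd z)"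
      "\<And>z. M1 (1, z) = c" "\<And>t z. t \<in> {0..1} \<Longrightarrow> z \<in> {p} \<times> S \<Longrightarrow> M1 (t, z) = c"
    by (rule homotopic_with_constE[OF null_rel[OF \<phi>p(1,2) \<phi>(3) null(1)]]) (rule that; assumption)
  obtain M2 where M2: "continuous_on ?D M2" "M2 \<in> ?D \<rightarrow> Y" "\<And>z. M2 (0, z) = \<pi> (\<phi> (p, fst z), snd z)"
      "\<And>z. M2 (1, z) = c" "\<And>t z. t \<in> {0..1} \<Longrightarrow> z \<in> {p} \<times> S \<Longrightarrow> M2 (t, z) = c"
    by (rule homotopic_with_constE[OF null_rel[OF \<phi>p(3,4) \<phi>(3) null(2)]]) (rule that; assumption)
  \<comment> \<open>The axes meet only in \<open>(p, p)\<close>, where \<open>M1\<close> and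
    \<open>M2\<close> are both \<open>c\<close>, so giving preference to one axis is
    harmless.\<close>
  define F where "F w = (if snd (u' (fst (snd w))) = p then M1 (fst w, (fst (u' (fst (snd w))), snd (snd w)))
      else M2 (fst w, (snd (u' (fst (snd w))), snd (snd w))))" for w :: "real \<times> 'b \<times> 'b"
  define D1 where "D1 = {w \<in> ?D. snd (u' (fst (snd w))) = p}"
  define D2 where "D2 = {w \<in> ?D. fst (u' (fst (snd w))) = p}"
  have "w \<in> D1 \<or> w \<in> D2" if "w \<in> ?D" for w
    using u'(2)[of "fst (snd w)"] that by (auto simp: D1_def D2_def)
  then have D12: "?D = D1 \<union> D2"
    by (auto simp: D1_def D2_def)
  have u'D: "fst (u' (fst (snd w))) \<in> S" "snd (u' (fst (snd w))) \<in> S" if "w \<in> ?D" for w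
    using u'S that by (auto simp: Pi_iff mem_Times_iff)
  have cu': "continuous_on A (\<lambda>w. u' (fst (snd w)))" if "A \<subseteq> ?D" for A
    by (rule continuous_on_compose2[OF contu']) (use that in \<open>auto intro!: continuous_intros\<close>)
  have F2: "F w = M2 (fst w, (snd (u' (fst (snd w))), snd (snd w)))" if "w \<in> D2" for w
  proof (cases "snd (u' (fst (snd w))) = p")
    case True
    then have "F w = c" "M2 (fst w, (snd (u' (fst (snd w))), snd (snd w))) = c"
      using that M1(5)[of "fst w" "(p, snd (snd w))"] M2(5)[of "fst w" "(p, snd (snd w))"]
      by (auto simp: F_def D2_def)
    then show ?thesis by simp
  qed (simp add: F_def)
  have in1: "(fst w, (fst (u' (fst (snd w))), snd (snd w))) \<in> ?D"
    and in2: "(fst w, (snd (u' (fst (snd w))), snd (snd w))) \<in> ?D" if "w \<in> ?D" for w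
    using that u'D[OF that] by auto
  have contF: "continuous_on ?D F"
  proof -
    have "continuous_on D1 F"
    proof (rule continuous_on_eq)
      show "continuous_on D1 (\<lambda>w. M1 (fst w, (fst (u' (fst (snd w))), snd (snd w))))"
        by (intro continuous_on_compose2[OF M1(1)] continuous_intros cu') (use in1 in \<open>auto simp: D1_def\<close>)
    qed (simp add: F_def D1_def)
    moreover have "continuous_on D2 F"
    proof (rule continuous_on_eq)
      show "continuous_on D2 (\<lambda>w. M2 (fst w, (snd (u' (fst (snd w))), snd (snd w))))"
        by (intro continuous_on_compose2[OF M2(1)] continuous_intros cu') (use in2 in \<open>auto simp: D2_def\<close>)
    qed (simp add: F2)
    moreover have "closedin (top_of_set ?D) D1" "closedin (top_of_set ?D) D2"
      unfolding D1_def D2_def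
      by (intro continuous_closedin_preimage_constant continuous_intros cu'; simp)+
    ultimately show ?thesis
      unfolding D12 by (intro continuous_on_Un_local)
  qed
  have FY: "F \<in> ?D \<rightarrow> Y"
    using M1(2) M2(2) in1 in2 by (auto simp: F_def Pi_iff)
  have "homotopic_with_canon (\<lambda>h. \<forall>z\<in>?Z \<times> S. h z = c) (S \<times> S) Y
      (\<lambda>z. \<pi> (\<phi> (u' (fst z)), snd z)) (\<lambda>_. c)"
  proof (rule homotopic_with_constI[OF contF FY])
    fix z assume z: "z \<in> S \<times> S"
    then have "fst z \<in> S" by auto
    then consider "snd (u' (fst z)) = p" | "fst (u' (fst z)) = p" "snd (u' (fst z)) \<noteq> p"
      using u'(2) by blast
    then show "F (0, z) = \<pi> (\<phi> (u' (fst z)), snd z)"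
    proof cases
      case 1
      then have "(fst (u' (fst z)), p) = u' (fst z)"
        by (simp add: prod_eq_iff)
      with 1 show ?thesis
        by (simp add: F_def M1(3))
    next
      case 2
      then have "(p, snd (u' (fst z))) = u' (fst z)"
        by (simp add: prod_eq_iff)
      with 2 show ?thesis
        by (simp add: F_def M2(3))
    qed
    show "F (1, z) = c"
      by (simp add: F_def M1(4) M2(4))
  next
    fix t :: real and z assume tz: "t \<in> {0..1}" "z \<in> ?Z \<times> S"
    then have "u' (fst z) = (p, p)"
      using u'Z by auto
    then show "F (t, z) = c"
      using M1(5)[of t "(p, snd z)"] tz by (auto simp: F_def)
  qed auto
  from homotopic_with_trans[OF 1 this] show ?thesis .
qed

end

subsection \<open>The wedges are not homotopy equivalent\<close>

context collapse_map
begin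

text \<open>All but finitely many pieces are mapped by \<open>R\<close> into the unit ball around \<open>- p\<close> and are
  handled together by a straight-line homotopy; the others are handled one by one.\<close>
lemma null_glue:
  fixes A :: "nat \<Rightarrow> 'a::euclidean_space set"
  assumes A: "compact_wedge A"
    and hk: "\<And>j. homeomorphism (A j) (S \<times> S) (h j) (k j)" "\<And>j. h j 0 = (p, p)"
    and R: "continuous_on (\<Union>j. A j) R" "R \<in> (\<Union>j. A j) \<rightarrow> S" "R 0 = - p"
    and \<iota>: "continuous_on S \<iota>" "\<iota> \<in> S \<rightarrow> (\<Union>j. A j)"
    and null1: "\<And>j. null (\<lambda>z. \<pi> (R (k j (fst z, p)), snd z))"
    and null2: "\<And>j. null (\<lambda>z. \<pi> (R (k j (p, fst z)), snd z))"
  shows "null (\<lambda>z. \<pi> (R (\<iota> (fst z)), snd z))"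
proof -
  interpret A: compact_wedge A by fact
  let ?X = "\<Union>j. A j"
  let ?D = "{0..1} \<times> (S \<times> S) :: (real \<times> 'b \<times> 'b) set"
  \<comment> \<open>The part of \<iota> in piece \<open>j\<close>, in coordinates: points that
    \<iota> sends to other pieces go to \<open>(p, p)\<close>.\<close>
  define u where "u j x = h j (A.collapse {j} (\<iota> x))" for j x
  have conth: "continuous_on (A j) (h j)" and imh: "h j ` A j = S \<times> S"
    and contk: "continuous_on (S \<times> S) (k j)" and imk: "k j ` (S \<times> S) = A j" for j
    using hk(1)[of j] by (simp_all add: homeomorphism_def)
  have coll: "A.collapse {j} x \<in> A j" for j x
    using A.collapse_in[of "{j}" x] by simp
  have u: "continuous_on S (u j)" "u j \<in> S \<rightarrow> S \<times> S" for j
  proof -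
    have "continuous_on S (\<lambda>x. A.collapse {j} (\<iota> x))"
      by (rule continuous_on_compose2[OF A.continuous_on_collapse \<iota>(1)]) (use \<iota>(2) in auto)
    then show "continuous_on S (u j)"
      unfolding u_def by (rule continuous_on_compose2[OF conth]) (use coll in auto)
    show "u j \<in> S \<rightarrow> S \<times> S"
      unfolding u_def using coll imh by blast
  qed
  have ku: "k j (u j x) = \<iota> x" if "\<iota> x \<in> A j" for j x
    using that homeomorphism_apply1[OF hk(1)] by (simp add: u_def A.collapse_id[of j "{j}"])
  have u0: "u j x = (p, p)" if "\<iota> x = 0" for j x
    using that hk(2) by (simp add: u_def A.collapse_def)
  have k0: "k j (p, p) = 0" for j
    using homeomorphism_apply1[OF hk(1), of 0 j] hk(2) by simp
  define Q where "Q j N \<longleftrightarrow> continuous_on ?D N \<and> N \<in> ?D \<rightarrow> Y \<and>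
      (\<forall>z. N (0, z) = \<pi> (R (k j (u j (fst z))), snd z)) \<and> (\<forall>z. N (1, z) = c) \<and>
      (\<forall>t\<in>{0..1}. \<forall>z\<in>{x \<in> S. u j x = (p, p)} \<times> S. N (t, z) = c)" for j N
  have "\<exists>N. Q j N" for j
  proof -
    have "homotopic_with_canon (\<lambda>h. \<forall>z\<in>{x \<in> S. u j x = (p, p)} \<times> S. h z = c) (S \<times> S) Y
        (\<lambda>z. \<pi> (R (k j (u j (fst z))), snd z)) (\<lambda>_. c)"
    proof (rule null_factor[where \<phi> = "\<lambda>z. R (k j z)"])
      show "continuous_on (S \<times> S) (\<lambda>z. R (k j z))"
        by (rule continuous_on_compose2[OF R(1) contk]) (use imk in auto)
      show "(\<lambda>z. R (k j z)) \<in> S \<times> S \<rightarrow> S"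
        using R(2) imk[of j] by blast
      show "R (k j (p, p)) = - p"
        by (simp add: k0 R(3))
    qed (rule null1 null2 u)+
    then show ?thesis
    proof (rule homotopic_with_constE)
      fix K
      assume "continuous_on ?D K" "K \<in> ?D \<rightarrow> Y"
        and "\<And>z. K (0, z) = \<pi> (R (k j (u j (fst z))), snd z)" "\<And>z. K (1, z) = c"
        and "\<And>t z. t \<in> {0..1} \<Longrightarrow> z \<in> {x \<in> S. u j x = (p, p)} \<times> S \<Longrightarrow> K (t, z) = c"
      then show ?thesis
        by (intro exI[of _ K]) (simp only: Q_def, simp)
    qed
  qed
  then obtain N where "\<And>j. Q j (N j)"
    by metis
  then have N: "\<And>j. continuous_on ?D (N j)" "\<And>j. N j \<in> ?D \<rightarrow> Y"
      "\<And>j z. N j (0, z) = \<pi> (R (k j (u j (fst z))), snd z)" "\<And>j z. N j (1, z) = c"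
      "\<And>j t z. t \<in> {0..1} \<Longrightarrow> z \<in> {x \<in> S. u j x = (p, p)} \<times> S \<Longrightarrow> N j (t, z) = c"
    unfolding Q_def by blast+
  \<comment> \<open>Radius 1, because the segment to \<open>- p\<close> from a point at distance
    less than 1 avoids 0 and can be normalised.\<close>
  obtain d where d: "d > 0" "\<And>x. x \<in> ?X \<Longrightarrow> norm x < d \<Longrightarrow> dist (R x) (- p) < 1"
  proof -
    have "0 \<in> ?X" by simp
    then have "\<exists>d>0. \<forall>x\<in>?X. dist x 0 < d \<longrightarrow> dist (R x) (R 0) < 1"
      using R(1) zero_less_one unfolding continuous_on_iff by blast
    then show ?thesis
      using that R(3) by auto
  qed
  obtain M where M: "\<And>j x. M \<le> j \<Longrightarrow> x \<in> A j \<Longrightarrow> norm x < d"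
    using A.pieces_small[OF d(1)] by blast
  define T where "T = (\<Union>j\<in>{M..}. A j)"
  have closedT: "closed T"
    unfolding T_def by (rule A.closed_subwedge)
  have TX: "T \<subseteq> ?X"
    by (auto simp: T_def)
  have RT: "dist (R x) (- p) < 1" "R x \<in> S" if "x \<in> T" for x
    using that d(2) M TX R(2) by (auto simp: T_def Pi_iff)
  define L where "L t x = nrmlz ((1 - t) *\<^sub>R R x + t *\<^sub>R (- p))" for t x
  have ne: "(1 - t) *\<^sub>R R x + t *\<^sub>R (- p) \<noteq> 0" if "t \<in> {0..1}" "x \<in> T" for t x
  proof
    assume "(1 - t) *\<^sub>R R x + t *\<^sub>R (- p) = 0"
    then have "p = (1 - t) *\<^sub>R (R x - - p)"
      by (simp add: algebra_simps)
    then have "norm p = norm ((1 - t) *\<^sub>R (R x - - p))"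
      by (rule arg_cong)
    also have "\<dots> = (1 - t) * norm (R x - - p)"
      using that(1) by simp
    also have "\<dots> \<le> 1 * norm (R x - - p)"
      using that(1) by (intro mult_right_mono) auto
    finally show False
      using RT(1)[OF that(2)] p by (simp add: dist_norm)
  qed
  have LS: "L t x \<in> S" if "t \<in> {0..1}" "x \<in> T" for t x
    using ne[OF that] by (simp add: L_def)
  \<comment> \<open>Index \<open>M\<close> stands for the whole tail, so the preimages
    \<open>C i\<close> with \<open>i \<le> M\<close> form a finite closed cover of the
    sphere.\<close>
  define B where "B i = (if i < M then A i else T)" for i
  define F where "F i = (if i < M then N i else (\<lambda>w. \<pi> (L (fst w) (\<iota> (fst (snd w))), snd (snd w))))" for i
  define C where "C i = {x \<in> S. \<iota> x \<in> B i}" for i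
  have closedB: "closed (B i)" for i
    using closedT compact_imp_closed[OF A.compact_piece] by (simp add: B_def)
  have closedC: "closed (C i)" for i
  proof -
    have "closedin (top_of_set S) (S \<inter> \<iota> -` B i)"
      by (rule continuous_closedin_preimage[OF \<iota>(1) closedB])
    moreover have "S \<inter> \<iota> -` B i = C i"
      by (auto simp: C_def)
    ultimately show ?thesis
      by (metis closed_sphere closedin_closed_trans)
  qed
  have contF: "continuous_on ({0..1} \<times> (C i \<times> S)) (F i)" for i
  proof (cases "i < M")
    case True
    show ?thesis
      using True by (simp add: F_def) (rule continuous_on_subset[OF N(1)], auto simp: C_def)
  next
    case False
    let ?E = "{0..1::real} \<times> (C i \<times> S)"
    have TE: "\<iota> (fst (snd w)) \<in> T" "fst (snd w) \<in> S" "fst w \<in> {0..1}" "snd (snd w) \<in> S" if "w \<in> ?E" for w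
      using that False by (auto simp: C_def B_def)
    have cR: "continuous_on ?E (\<lambda>w. R (\<iota> (fst (snd w))))"
    proof (rule continuous_on_compose2[OF R(1)])
      show "continuous_on ?E (\<lambda>w. \<iota> (fst (snd w)))"
        by (rule continuous_on_compose2[OF \<iota>(1)]) (use TE in \<open>auto intro!: continuous_intros\<close>)
      show "(\<lambda>w. \<iota> (fst (snd w))) ` ?E \<subseteq> ?X"
        by (intro image_subsetI subsetD[OF TX TE(1)])
    qed
    have cL: "continuous_on ?E (\<lambda>w. L (fst w) (\<iota> (fst (snd w))))"
      unfolding L_def
    proof (rule continuous_on_nrmlz)
      show "continuous_on ?E (\<lambda>w. (1 - fst w) *\<^sub>R R (\<iota> (fst (snd w))) + fst w *\<^sub>R (- p))"
        by (intro continuous_on_add continuous_on_scaleR continuous_on_diff continuous_on_const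
            continuous_on_fst continuous_on_id cR)
      show "(1 - fst w) *\<^sub>R R (\<iota> (fst (snd w))) + fst w *\<^sub>R (- p) \<noteq> 0" if "w \<in> ?E" for w
        by (rule ne[OF TE(3,1)[OF that]])
    qed
    have "continuous_on ?E (\<lambda>w. \<pi> (L (fst w) (\<iota> (fst (snd w))), snd (snd w)))"
    proof (rule continuous_on_compose2[OF cont_\<pi>])
      show "continuous_on ?E (\<lambda>w. (L (fst w) (\<iota> (fst (snd w))), snd (snd w)))"
        by (intro continuous_intros cL)
      show "(\<lambda>w. (L (fst w) (\<iota> (fst (snd w))), snd (snd w))) ` ?E \<subseteq> S \<times> S"
        by (intro image_subsetI SigmaI LS TE)
    qed
    then show ?thesis
      using False by (simp add: F_def)
  qed
  have FY: "F i w \<in> Y" if "w \<in> {0..1} \<times> (C i \<times> S)" for i w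
  proof (cases "i < M")
    case True
    have "w \<in> ?D"
      using that by (auto simp: C_def)
    then show ?thesis
      using funcset_mem[OF N(2)] True by (simp add: F_def)
  next
    case False
    have "(L (fst w) (\<iota> (fst (snd w))), snd (snd w)) \<in> S \<times> S"
      using that False LS[of "fst w" "\<iota> (fst (snd w))"] by (auto simp: C_def B_def)
    then show ?thesis
      using funcset_mem[OF \<pi>_in] False by (simp add: F_def)
  qed
  have F0: "F i (0, z) = \<pi> (R (\<iota> (fst z)), snd z)" if "z \<in> C i \<times> S" for i z
    using that ku N(3) RT(2) by (auto simp: F_def C_def B_def L_def split: if_splits)
  have F1: "F i (1, z) = c" if "z \<in> C i \<times> S" for i z
    using that N(4) \<pi>_base p by (auto simp: F_def L_def)
  \<comment> \<open>Over the base point every \<open>F i\<close> is constantly \<open>c\<close>. By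
    \<open>Bunique\<close> the sets overlap nowhere else, so the choice of \<open>i\<close> in
    \<open>G\<close> is immaterial.\<close>
  have Fbase: "F i (t, z) = c" if "t \<in> {0..1}" "z \<in> C i \<times> S" "\<iota> (fst z) = 0" for i t z
  proof (cases "i < M")
    case True
    then show ?thesis
      using N(5)[OF that(1)] that u0 by (auto simp: F_def C_def)
  next
    case False
    have "(1 - t) *\<^sub>R (- p) + t *\<^sub>R (- p) = - p"
      by (simp only: scaleR_add_left[symmetric]) simp
    then show ?thesis
      using False that \<pi>_base p R(3) by (auto simp: F_def L_def)
  qed
  have Bunique: "i = i'" if xB: "x \<in> B i" "x \<in> B i'" "x \<noteq> 0" "i \<le> M" "i' \<le> M" for x i i'
  proof -
    have B_piece: "\<exists>j. x \<in> A j \<and> (if l < M then j = l else M \<le> j)" if "x \<in> B l" for l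
      using that by (cases "l < M") (auto simp: B_def T_def)
    obtain j j' where j: "x \<in> A j" "if i < M then j = i else M \<le> j"
        "x \<in> A j'" "if i' < M then j' = i' else M \<le> j'"
      using B_piece[OF xB(1)] B_piece[OF xB(2)] by blast
    then have "j = j'"
      using A.piece_unique xB(3) by blast
    with j(2,4) xB(4,5) show ?thesis
      by (auto split: if_splits)
  qed
  define G where "G w = F (SOME i. i \<le> M \<and> fst (snd w) \<in> C i) w" for w :: "real \<times> 'b \<times> 'b"
  have G: "G w = F i w" if "i \<le> M" "w \<in> {0..1} \<times> (C i \<times> S)" for i w
  proof -
    let ?i = "SOME i. i \<le> M \<and> fst (snd w) \<in> C i"
    have i: "?i \<le> M \<and> fst (snd w) \<in> C ?i"
      by (rule someI[of _ i]) (use that in auto)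
    show ?thesis
    proof (cases "\<iota> (fst (snd w)) = 0")
      case True
      have "w = (fst w, snd w)" "fst w \<in> {0..1}" "snd w \<in> C i \<times> S" "snd w \<in> C ?i \<times> S"
        using that(2) i by (auto simp: mem_Times_iff)
      then have "F ?i w = c" "F i w = c"
        using Fbase[of "fst w" "snd w"] True by simp_all
      then show ?thesis
        by (simp add: G_def)
    next
      case False
      have "fst (snd w) \<in> C i"
        using that(2) by auto
      then have "?i = i"
        using Bunique[of "\<iota> (fst (snd w))" ?i i] i False that(1) by (simp add: C_def)
      then show ?thesis
        by (simp add: G_def)
    qed
  qed
  have cover: "\<exists>i\<le>M. x \<in> C i" if "x \<in> S" for x
  proof -
    have "\<iota> x \<in> ?X"
      using \<iota>(2) that by (rule funcset_mem)
    then obtain j where j: "\<iota> x \<in> A j"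
      by blast
    show ?thesis
    proof (cases "j < M")
      case True
      with j that show ?thesis
        by (intro exI[of _ j]) (simp add: C_def B_def)
    next
      case False
      with j that show ?thesis
        by (intro exI[of _ M]) (auto simp: C_def B_def T_def)
    qed
  qed
  have "C i \<subseteq> S" for i
    by (auto simp: C_def)
  moreover have "x \<in> (\<Union>i\<in>{..M}. C i)" if "x \<in> S" for x
    using cover[OF that] by blast
  ultimately have "S = (\<Union>i\<in>{..M}. C i)"
    by blast
  then have Deq: "?D = (\<Union>i\<in>{..M}. {0..1} \<times> (C i \<times> S))"
    by blast
  have contG: "continuous_on ?D G"
    unfolding Deq
  proof (rule continuous_on_closed_Union)
    show "continuous_on ({0..1} \<times> (C i \<times> S)) G" if "i \<in> {..M}" for i
      using that G by (intro continuous_on_eq[OF contF[of i]]) auto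
    show "closed ({0..1::real} \<times> (C i \<times> S))" for i
      by (intro closed_Times closedC closed_sphere) simp
  qed simp
  have "homotopic_with_canon (\<lambda>h. True) (S \<times> S) Y (\<lambda>z. \<pi> (R (\<iota> (fst z)), snd z)) (\<lambda>_. c)"
  proof (rule homotopic_with_canonI[OF contG])
    show "G \<in> ?D \<rightarrow> Y"
    proof
      fix w assume "w \<in> ?D"
      then obtain i where "i \<le> M" "w \<in> {0..1} \<times> (C i \<times> S)"
        unfolding Deq by blast
      then show "G w \<in> Y"
        using G FY by simp
    qed
    fix z assume z: "z \<in> S \<times> S"
    then have "fst z \<in> S" by auto
    then obtain i where "i \<le> M" "fst z \<in> C i"
      using cover by blast
    with z have i: "i \<le> M" "z \<in> C i \<times> S"
      by (auto simp: mem_Times_iff)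
    then show "G (0, z) = \<pi> (R (\<iota> (fst z)), snd z)" "G (1, z) = c"
      using G[OF i(1), of "(0, z)"] G[OF i(1), of "(1, z)"] F0[OF i(2)] F1[OF i(2)] by auto
  qed
  then show ?thesis
    unfolding null_def by blast
qed

lemma homotopic_pair:
  fixes X :: "'c::topological_space set"
  assumes "homotopic_with_canon (\<lambda>h. True) X S f f'" "homotopic_with_canon (\<lambda>h. True) X S g g'"
  shows "homotopic_with_canon (\<lambda>h. True) X Y (\<lambda>x. \<pi> (f x, g x)) (\<lambda>x. \<pi> (f' x, g' x))"
proof -
  obtain K :: "real \<times> 'c \<Rightarrow> 'b" where K: "continuous_on ({0..1} \<times> X) K" "K \<in> {0..1} \<times> X \<rightarrow> S"
      "\<And>x. K (0, x) = f x" "\<And>x. K (1, x) = f' x"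
    by (rule homotopic_with_canonE[OF assms(1)]) (rule that; assumption)
  obtain L :: "real \<times> 'c \<Rightarrow> 'b" where L: "continuous_on ({0..1} \<times> X) L" "L \<in> {0..1} \<times> X \<rightarrow> S"
      "\<And>x. L (0, x) = g x" "\<And>x. L (1, x) = g' x"
    by (rule homotopic_with_canonE[OF assms(2)]) (rule that; assumption)
  have in_S: "(K w, L w) \<in> S \<times> S" if "w \<in> {0..1} \<times> X" for w
    using funcset_mem[OF K(2) that] funcset_mem[OF L(2) that] by (rule SigmaI)
  show ?thesis
  proof (rule homotopic_with_canonI)
    show "continuous_on ({0..1} \<times> X) (\<lambda>w. \<pi> (K w, L w))"
      by (rule continuous_on_compose2[OF cont_\<pi> continuous_on_Pair[OF K(1) L(1)]]) (use in_S in blast)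
    show "(\<lambda>w. \<pi> (K w, L w)) \<in> {0..1} \<times> X \<rightarrow> Y"
      using funcset_mem[OF \<pi>_in in_S] by (rule Pi_I)
  qed (simp_all add: K L)
qed

text \<open>The chart \<open>a\<close> of the single sphere sends the base point to
  \<open>- p\<close>, so \<open>r\<close> sends all the other pieces to a point where \<pi> is
  \<open>c\<close> for every second argument. This is what makes \<pi> paired with \<open>r\<close>
  factor through the sphere.\<close>

lemma not_homotopy_eqv:
  fixes A B :: "nat \<Rightarrow> 'a::euclidean_space set"
  assumes A: "compact_wedge A" and B: "compact_wedge B"
    and hk: "\<And>j. homeomorphism (A j) (S \<times> S) (h j) (k j)" "\<And>j. h j 0 = (p, p)"
    and ab: "homeomorphism (B 0) S a b" "a 0 = - p"
    and essential: "\<not> null \<pi>"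
    and inessential: "\<And>m :: 'b \<Rightarrow> 'b \<times> 'b. continuous_on S m \<Longrightarrow> m \<in> S \<rightarrow> Y \<Longrightarrow>
       \<exists>a. homotopic_with_canon (\<lambda>h. True) S Y m (\<lambda>_. a)"
  shows "\<not> (\<Union>j. A j) homotopy_eqv (\<Union>j. B j)"
proof
  interpret A: compact_wedge A by fact
  interpret B: compact_wedge B by fact
  let ?X = "\<Union>j. A j" and ?Y = "\<Union>j. B j"
  assume "?X homotopy_eqv ?Y"
  then obtain f g where f: "continuous_on ?X f" "f \<in> ?X \<rightarrow> ?Y"
    and g: "continuous_on ?Y g" "g \<in> ?Y \<rightarrow> ?X"
    and gf: "homotopic_with_canon (\<lambda>h. True) ?X ?X (g \<circ> f) id"
    and fg: "homotopic_with_canon (\<lambda>h. True) ?Y ?Y (f \<circ> g) id"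
    unfolding homotopy_equivalent_space_def by auto
  have conta: "continuous_on (B 0) a" and ima: "a ` B 0 = S"
    and contb: "continuous_on S b" and imb: "b ` S = B 0"
    using ab(1) by (simp_all add: homeomorphism_def)
  have contk: "continuous_on (S \<times> S) (k j)" and imk: "k j ` (S \<times> S) = A j"
    and conth: "continuous_on (A j) (h j)" and imh: "h j ` A j = S \<times> S" for j
    using hk(1)[of j] by (simp_all add: homeomorphism_def)
  have collB: "B.collapse {0} y \<in> B 0" for y
    using B.collapse_in[of "{0}" y] by simp
  define r where "r y = a (B.collapse {0} y)" for y
  have contr: "continuous_on ?Y r"
    unfolding r_def by (rule continuous_on_compose2[OF conta B.continuous_on_collapse]) (use collB in blast)
  have rS: "r \<in> ?Y \<rightarrow> S"
    unfolding r_def using collB ima by blast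
  have rb: "r (b x) = x" if "x \<in> S" for x
  proof -
    have "b x \<in> B 0"
      using imb that by blast
    then show ?thesis
      using homeomorphism_apply2[OF ab(1) that] by (simp add: r_def B.collapse_id[of 0 "{0}"])
  qed
  have contrf: "continuous_on ?X (r \<circ> f)"
    by (rule continuous_on_compose[OF f(1) continuous_on_subset[OF contr]]) (use f(2) in blast)
  have rfS: "r \<circ> f \<in> ?X \<rightarrow> S"
    using funcset_mem[OF rS funcset_mem[OF f(2)]] by (intro Pi_I) (simp only: comp_apply)
  \<comment> \<open>The equivalence need not respect base points. A path from \<open>r (f 0)\<close>
    to \<open>- p\<close>, extended from \<open>{0}\<close> to the wedge, corrects the
    value.\<close>
  obtain R where R: "continuous_on ?X R" "R \<in> ?X \<rightarrow> S" "R 0 = - p"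
      "homotopic_with_canon (\<lambda>h. True) ?X S (r \<circ> f) R"
  proof -
    have "path_connected S"
      using dim by (intro path_connected_sphere) auto
    moreover have "(r \<circ> f) 0 \<in> S"
      using rfS by (rule funcset_mem) simp
    ultimately obtain \<gamma> where \<gamma>: "path \<gamma>" "path_image \<gamma> \<subseteq> S" "pathstart \<gamma> = (r \<circ> f) 0" "pathfinish \<gamma> = - p"
      using minus_p unfolding path_connected_def by blast
    have clo: "closedin (top_of_set ?X) {0}"
      by (rule closed_subset) auto
    have c\<gamma>: "continuous_on ({0..1} \<times> {0::'a}) (\<lambda>w. \<gamma> (fst w))"
      using \<gamma>(1) unfolding path_def
      by (rule continuous_on_compose2) (auto intro!: continuous_intros)
    have \<gamma>S: "(\<lambda>w. \<gamma> (fst w)) \<in> {0..1} \<times> {0::'a} \<rightarrow> S"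
      using \<gamma>(2) by (auto simp: path_image_def)
    have \<gamma>0: "\<gamma> (fst (0, x)) = (r \<circ> f) x" if "x \<in> {0}" for x
      using \<gamma>(3) that by (simp add: pathstart_def)
    obtain H where H: "continuous_on ({0..1} \<times> ?X) H" "H \<in> {0..1} \<times> ?X \<rightarrow> S"
      "\<And>x. x \<in> ?X \<Longrightarrow> H (0, x) = (r \<circ> f) x" "\<And>t x. t \<in> {0..1} \<Longrightarrow> x \<in> {0} \<Longrightarrow> H (t, x) = \<gamma> (fst (t, x))"
      by (rule homotopy_extension[OF clo ANR_sphere contrf rfS c\<gamma> \<gamma>S \<gamma>0], assumption) (rule that; assumption)
    have hom: "homotopic_with_canon (\<lambda>h. True) ?X S (r \<circ> f) (\<lambda>x. H (1, x))"
      by (rule homotopic_with_canonI[OF H(1,2)]) (use H(3) in auto)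
    show thesis
    proof (rule that[OF _ _ _ hom])
      show "continuous_on ?X (\<lambda>x. H (1, x))"
        using homotopic_with_imp_continuous[OF hom] by blast
      show "(\<lambda>x. H (1, x)) \<in> ?X \<rightarrow> S"
        by (rule homotopic_with_imp_funspace2[OF hom])
      show "H (1, 0) = - p"
        using H(4)[of 1 0] \<gamma>(4) by (simp add: pathfinish_def)
    qed
  qed
  \<comment> \<open>Up to homotopy \<open>R\<close> is \<open>r \<circ> f\<close> and \<psi> is
    \<open>\<psi> \<circ> g \<circ> f\<close>, so the map becomes \<open>m \<circ> f\<close>. On the
    second wedge \<open>m\<close> equals \<open>m \<circ> b \<circ> r\<close>, and
    \<open>m \<circ> b\<close> is inessential.\<close>
  have key: "\<exists>e. homotopic_with_canon (\<lambda>h. True) ?X Y (\<lambda>x. \<pi> (R x, \<psi> x)) (\<lambda>_. e)"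
    if \<psi>: "continuous_on ?X \<psi>" "\<psi> \<in> ?X \<rightarrow> S" for \<psi>
  proof -
    define m where "m y = \<pi> (r y, \<psi> (g y))" for y
    have "continuous_on ?Y (\<lambda>y. \<psi> (g y))"
      by (rule continuous_on_compose2[OF \<psi>(1) g(1)]) (use g(2) in blast)
    moreover have "(\<lambda>y. \<psi> (g y)) \<in> ?Y \<rightarrow> S"
      using funcset_mem[OF \<psi>(2) funcset_mem[OF g(2)]] by (rule Pi_I)
    ultimately have \<psi>g: "continuous_on ?Y (\<lambda>y. \<psi> (g y))" "(\<lambda>y. \<psi> (g y)) \<in> ?Y \<rightarrow> S" .
    have pair_in: "(r y, \<psi> (g y)) \<in> S \<times> S" if "y \<in> ?Y" for y
      using funcset_mem[OF rS that] funcset_mem[OF \<psi>g(2) that] by (rule SigmaI)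
    have contm: "continuous_on ?Y m"
      unfolding m_def
      by (rule continuous_on_compose2[OF cont_\<pi> continuous_on_Pair[OF contr \<psi>g(1)]]) (use pair_in in blast)
    have mY: "m y \<in> Y" if "y \<in> ?Y" for y
      unfolding m_def by (rule funcset_mem[OF \<pi>_in pair_in[OF that]])
    have B0: "B 0 \<subseteq> ?Y" by blast
    have mb: "continuous_on S (m \<circ> b)"
      by (rule continuous_on_compose[OF contb continuous_on_subset[OF contm]]) (use imb B0 in blast)
    have bB: "b x \<in> ?Y" if "x \<in> S" for x
      using imb B0 that by blast
    have mbY: "m \<circ> b \<in> S \<rightarrow> Y"
      using mY[OF bB] by (intro Pi_I) (simp only: comp_apply)
    obtain e where e: "homotopic_with_canon (\<lambda>h. True) S Y (m \<circ> b) (\<lambda>_. e)"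
      using inessential[OF mb mbY] by blast
    \<comment> \<open>Outside \<open>B 0\<close> both sides are \<open>c\<close>, because
      \<open>r\<close> takes there the value \<open>- p\<close> that it has at 0.\<close>
    have mc: "m (b (r y)) = m y" if y: "y \<in> ?Y" for y
    proof -
      obtain j where j: "y \<in> B j" using y by blast
      have br: "b (r y) = B.collapse {0} y"
        unfolding r_def by (rule homeomorphism_apply1[OF ab(1) collB])
      show ?thesis
      proof (cases "j = 0")
        case True
        then show ?thesis
          using j by (simp add: br B.collapse_id[of 0 "{0}"])
      next
        case False
        then have c0: "B.collapse {0} y = 0"
          using B.collapse_zero[of j "{0}" y] j by simp
        have r0: "r y = - p" "r 0 = - p"
          using c0 ab(2) by (simp_all add: r_def B.collapse_def)
        have "\<psi> (g y) \<in> S" "\<psi> (g 0) \<in> S"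
          using funcset_mem[OF \<psi>g(2)] y B.zero_in_piece by blast+
        then have "m y = c" "m 0 = c"
          using \<pi>_base r0 by (simp_all add: m_def)
        then show ?thesis
          by (simp add: br c0)
      qed
    qed
    have rf_in: "f x \<in> ?Y" "(r \<circ> f) x \<in> S" if "x \<in> ?X" for x
      using funcset_mem[OF f(2) that] funcset_mem[OF rfS that] by auto
    have "homotopic_with_canon (\<lambda>h. True) ?X Y ((m \<circ> b) \<circ> (r \<circ> f)) ((\<lambda>_. e) \<circ> (r \<circ> f))"
      by (rule homotopic_with_compose_continuous_right[OF e contrf rfS])
    then have 1: "homotopic_with_canon (\<lambda>h. True) ?X Y (\<lambda>x. m (f x)) (\<lambda>_. e)"
      by (rule homotopic_with_eq) (use mc rf_in(1) in auto)
    have "homotopic_with_canon (\<lambda>h. True) ?X S (\<psi> \<circ> id) (\<psi> \<circ> (g \<circ> f))"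
      by (rule homotopic_with_compose_continuous_left[OF homotopic_with_symD[OF gf] \<psi>])
    from homotopic_pair[OF homotopic_with_symD[OF R(4)] this]
    have "homotopic_with_canon (\<lambda>h. True) ?X Y (\<lambda>x. \<pi> (R x, \<psi> x)) (\<lambda>x. m (f x))"
      by (simp add: m_def)
    from homotopic_with_trans[OF this 1] show ?thesis by blast
  qed
  \<comment> \<open>This applies \<open>key\<close> to a map that sees only piece \<open>j\<close>
    and pulls the result back along \<open>k j \<circ> s\<close>.\<close>
  have key': "null (\<lambda>z. \<pi> (R (k j (s z)), \<psi> (h j (k j (s z)))))"
    if \<psi>: "continuous_on (S \<times> S) \<psi>" "\<psi> \<in> S \<times> S \<rightarrow> S"
      and s: "continuous_on (S \<times> S) s" "s \<in> S \<times> S \<rightarrow> S \<times> S" for j \<psi> s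
  proof -
    have coll: "A.collapse {j} x \<in> A j" for x
      using A.collapse_in[of "{j}" x] by simp
    have ch: "continuous_on ?X (\<lambda>x. h j (A.collapse {j} x))"
      by (rule continuous_on_compose2[OF conth A.continuous_on_collapse]) (use coll in blast)
    have hin: "h j (A.collapse {j} x) \<in> S \<times> S" for x
      using imh coll by blast
    have "continuous_on ?X (\<lambda>x. \<psi> (h j (A.collapse {j} x)))"
      by (rule continuous_on_compose2[OF \<psi>(1) ch]) (use hin in blast)
    moreover have "(\<lambda>x. \<psi> (h j (A.collapse {j} x))) \<in> ?X \<rightarrow> S"
      using hin \<psi>(2) by blast
    ultimately obtain e where e: "homotopic_with_canon (\<lambda>h. True) ?X Y
        (\<lambda>x. \<pi> (R x, \<psi> (h j (A.collapse {j} x)))) (\<lambda>_. e)"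
      using key by blast
    have kin: "k j (s z) \<in> A j" if "z \<in> S \<times> S" for z
      using imk s(2) that by blast
    have "continuous_on (S \<times> S) (k j \<circ> s)"
      using continuous_on_compose2[OF contk s(1)] s(2) by (auto simp: o_def)
    moreover have "k j \<circ> s \<in> S \<times> S \<rightarrow> ?X"
      using kin by (intro Pi_I) auto
    ultimately have "homotopic_with_canon (\<lambda>h. True) (S \<times> S) Y
       ((\<lambda>x. \<pi> (R x, \<psi> (h j (A.collapse {j} x)))) \<circ> (k j \<circ> s)) ((\<lambda>_. e) \<circ> (k j \<circ> s))"
      by (rule homotopic_with_compose_continuous_right[OF e])
    then have "homotopic_with_canon (\<lambda>h. True) (S \<times> S) Y
       (\<lambda>z. \<pi> (R (k j (s z)), \<psi> (h j (k j (s z))))) (\<lambda>_. e)"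
      by (rule homotopic_with_eq) (use kin in \<open>auto simp: A.collapse_id[of j "{j}"]\<close>)
    then show ?thesis
      unfolding null_def by blast
  qed
  have hkj: "h j (k j z) = z" if "z \<in> S \<times> S" for j z
    by (rule homeomorphism_apply2[OF hk(1) that])
  have null_cong: "null G" if "null F" "\<And>z. z \<in> S \<times> S \<Longrightarrow> G z = F z" for F G
  proof -
    obtain e where "homotopic_with_canon (\<lambda>h. True) (S \<times> S) Y F (\<lambda>_. e)"
      using \<open>null F\<close> unfolding null_def by blast
    then have "homotopic_with_canon (\<lambda>h. True) (S \<times> S) Y G (\<lambda>_. e)"
      by (rule homotopic_with_eq) (simp_all only: topspace_euclidean_subtopology that(2))
    then show ?thesis
      unfolding null_def by blast
  qed
  \<comment> \<open>Here \<psi> recovers \<open>snd z\<close> from \<open>s z\<close>, as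
    \<open>null_axis\<close> requires. The identity yields one axis and the swap of the factors the
    other.\<close>
  have axis: "null (\<lambda>z. \<pi> (R (k j (s (fst z, p))), snd z))"
    if s: "continuous_on (S \<times> S) s" "s \<in> S \<times> S \<rightarrow> S \<times> S"
      and \<psi>: "continuous_on (S \<times> S) \<psi>" "\<psi> \<in> S \<times> S \<rightarrow> S" "\<And>z. z \<in> S \<times> S \<Longrightarrow> \<psi> (s z) = snd z" for j s \<psi>
  proof (rule null_axis[of "\<lambda>z. R (k j (s z))"])
    have kin: "k j (s z) \<in> ?X" if "z \<in> S \<times> S" for z
      using imk s(2) that by blast
    have "continuous_on (S \<times> S) (\<lambda>z. k j (s z))"
      using continuous_on_compose2[OF contk s(1)] s(2) by auto
    then show "continuous_on (S \<times> S) (\<lambda>z. R (k j (s z)))"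
      by (rule continuous_on_compose2[OF R(1)]) (use kin in blast)
    show "(\<lambda>z. R (k j (s z))) \<in> S \<times> S \<rightarrow> S"
      using kin R(2) by blast
    show "null (\<lambda>z. \<pi> (R (k j (s z)), snd z))"
    proof (rule null_cong[OF key'[OF \<psi>(1,2) s, of j]])
      fix z assume z: "z \<in> S \<times> S"
      show "\<pi> (R (k j (s z)), snd z) = \<pi> (R (k j (s z)), \<psi> (h j (k j (s z))))"
        using hkj[OF funcset_mem[OF s(2) z], of j] \<psi>(3)[OF z] by (simp only:)
    qed
  qed
  have null1: "null (\<lambda>z. \<pi> (R (k j (fst z, p)), snd z))" for j
    by (rule axis[of "\<lambda>z. z" snd j]) (auto intro!: continuous_intros)
  have null2: "null (\<lambda>z. \<pi> (R (k j (p, fst z)), snd z))" for j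
  proof -
    have "null (\<lambda>z. \<pi> (R (k j ((\<lambda>z. (snd z, fst z)) (fst z, p))), snd z))"
      by (rule axis[of "\<lambda>z. (snd z, fst z)" fst j]) (auto intro!: continuous_intros)
    then show ?thesis by simp
  qed
  have \<iota>: "continuous_on S (g \<circ> b)" "g \<circ> b \<in> S \<rightarrow> ?X"
  proof -
    have bY: "b ` S \<subseteq> ?Y"
      unfolding imb by blast
    show "continuous_on S (g \<circ> b)"
      by (rule continuous_on_compose[OF contb continuous_on_subset[OF g(1) bY]])
    show "g \<circ> b \<in> S \<rightarrow> ?X"
      using bY g(2) unfolding comp_def by blast
  qed
  have nullR: "null (\<lambda>z. \<pi> (R ((g \<circ> b) (fst z)), snd z))"
    by (rule null_glue[OF A hk R(1-3) \<iota> null1 null2])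
  have bY: "b \<in> S \<rightarrow> ?Y"
    using imb by blast
  have hom1: "homotopic_with_canon (\<lambda>h. True) S S ((r \<circ> f) \<circ> (g \<circ> b)) (R \<circ> (g \<circ> b))"
    by (rule homotopic_with_compose_continuous_right[OF R(4) \<iota>])
  have hom2: "homotopic_with_canon (\<lambda>h. True) S S (r \<circ> ((f \<circ> g) \<circ> b)) (r \<circ> (id \<circ> b))"
    by (rule homotopic_with_compose_continuous_left[OF
          homotopic_with_compose_continuous_right[OF fg contb bY] contr rS])
  \<comment> \<open>\<open>R \<circ> g \<circ> b\<close> is homotopic to
    \<open>r \<circ> f \<circ> g \<circ> b\<close>, hence to \<open>r \<circ> b\<close>, which is
    the identity of the sphere.\<close>
  have "homotopic_with_canon (\<lambda>h. True) S S (R \<circ> (g \<circ> b)) (r \<circ> (id \<circ> b))"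
    by (rule homotopic_with_trans[OF homotopic_with_symD[OF hom1[unfolded comp_assoc]] hom2[unfolded comp_assoc]])
  then have "homotopic_with_canon (\<lambda>h. True) S S (R \<circ> (g \<circ> b)) id"
    by (rule homotopic_with_eq) (auto simp: rb)
  then have "homotopic_with_canon (\<lambda>h. True) (S \<times> S) S ((R \<circ> (g \<circ> b)) \<circ> fst) (id \<circ> fst)"
    by (rule homotopic_with_compose_continuous_right) (auto intro!: continuous_intros)
  moreover have "homotopic_with_canon (\<lambda>h. True) (S \<times> S) S snd snd"
    by (auto intro!: continuous_intros)
  ultimately have "homotopic_with_canon (\<lambda>h. True) (S \<times> S) Y
      (\<lambda>z. \<pi> (((R \<circ> (g \<circ> b)) \<circ> fst) z, snd z)) (\<lambda>z. \<pi> ((id \<circ> fst) z, snd z))"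
    by (rule homotopic_pair)
  then have "null (\<lambda>z. \<pi> (R ((g \<circ> b) (fst z)), snd z)) \<longleftrightarrow> null \<pi>"
    using null_homotopic by (simp add: o_def)
  with nullR essential show False
    by simp
qed

end

theorem theorem3p8:
  fixes n :: nat
    and A0 A1 :: "nat \<Rightarrow> 'a::euclidean_space set"
    and Sph :: "'b::euclidean_space set"
  assumes "n \<ge> 2"
    and "DIM('a) = 2 * n + 2"
    and "DIM('b) = n + 1"
    and "Sph = sphere 0 1"
    and "shrinking_wedge A0"
    and "\<forall>j. A0 j homeomorphic (Sph \<times> Sph)"
    and "shrinking_wedge A1"
    and "A1 0 homeomorphic Sph"
    and "\<forall>j\<ge>1. A1 j homeomorphic (Sph \<times> Sph)"
  shows "h_equal (\<Union>j. A0 j) (\<Union>j. A1 j) \<and> \<not> ((\<Union>j. A0 j) homotopy_eqv (\<Union>j. A1 j))"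
proof -
  let ?S = "sphere (0::'b) 1"
  have dim: "DIM('b) \<ge> 3"
    using assms(1,3) by simp
  obtain p :: 'b where "p \<in> Basis"
    using nonempty_Basis by blast
  then have p: "p \<in> ?S" "- p \<in> ?S"
    by simp_all
  have hom0: "A0 j homeomorphic ?S \<times> ?S" and hom1: "A1 0 homeomorphic ?S"
    and hom1': "A1 (Suc j) homeomorphic ?S \<times> ?S" for j
    using assms(4,6,8,9) by simp_all
  have "compact (A0 j)" for j
    using homeomorphic_compactness[OF hom0[of j]] by (simp add: compact_Times)
  with assms(5) interpret A0: compact_wedge A0
    by unfold_locales
  have "compact (A1 j)" for j
    using homeomorphic_compactness[OF hom1] homeomorphic_compactness[OF hom1'[of "j - 1"]]
    by (cases j) (simp_all add: compact_Times)
  with assms(7) interpret A1: compact_wedge A1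
    by unfold_locales
  have "\<exists>h k. homeomorphism (A0 j) (?S \<times> ?S) h k \<and> h 0 = (p, p)" for j
    using homeomorphism_torus_pointed[OF hom0 A0.zero_in_piece p(1)] by metis
  then obtain h0 k0 where hk0: "\<And>j. homeomorphism (A0 j) (?S \<times> ?S) (h0 j) (k0 j)" "\<And>j. h0 j 0 = (p, p)"
    by metis
  have "\<exists>h k. homeomorphism (A1 (Suc j)) (?S \<times> ?S) h k \<and> h 0 = (p, p)" for j
    using homeomorphism_torus_pointed[OF hom1' A1.zero_in_piece p(1)] by metis
  then obtain h1 k1 where hk1: "\<And>j. homeomorphism (A1 (Suc j)) (?S \<times> ?S) (h1 j) (k1 j)" "\<And>j. h1 j 0 = (p, p)"
    by metis
  obtain a b where ab: "homeomorphism (A1 0) ?S a b" "a 0 = p"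
    by (rule homeomorphism_sphere_pointed[OF hom1 A1.zero_in_piece p(1)])
  \<comment> \<open>A second chart of the same sphere: the domination works with base value
    \<open>p\<close>, the non-equivalence with \<open>- p\<close>.\<close>
  obtain a' b' where ab': "homeomorphism (A1 0) ?S a' b'" "a' 0 = - p"
    by (rule homeomorphism_sphere_pointed[OF hom1 A1.zero_in_piece p(2)])
  have k0: "k0 j (p, p) = 0" for j
    using homeomorphism_apply1[OF hk0(1) A0.zero_in_piece] hk0(2) by simp
  have k1: "k1 j (p, p) = 0" for j
    using homeomorphism_apply1[OF hk1(1) A1.zero_in_piece] hk1(2) by simp
  have b0: "b p = 0"
    using homeomorphism_apply1[OF ab(1) A1.zero_in_piece] ab(2) by simp
  have h0S: "h0 j x \<in> ?S \<times> ?S" if "x \<in> A0 j" for j x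
    unfolding homeomorphism_image1[OF hk0(1), of j, symmetric] using that by (rule imageI)
  have h1S: "h1 j x \<in> ?S \<times> ?S" if "x \<in> A1 (Suc j)" for j x
    unfolding homeomorphism_image1[OF hk1(1), of j, symmetric] using that by (rule imageI)
  have k0A: "k0 j z \<in> A0 j" if "z \<in> ?S \<times> ?S" for j z
    unfolding homeomorphism_image2[OF hk0(1), of j, symmetric] using that by (rule imageI)
  have k1A: "k1 j z \<in> A1 (Suc j)" if "z \<in> ?S \<times> ?S" for j z
    unfolding homeomorphism_image2[OF hk1(1), of j, symmetric] using that by (rule imageI)
  have aS: "a x \<in> ?S" if "x \<in> A1 0" for x
    unfolding homeomorphism_image1[OF ab(1), symmetric] using that by (rule imageI)
  have bA: "b y \<in> A1 0" if "y \<in> ?S" for y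
    unfolding homeomorphism_image2[OF ab(1), symmetric] using that by (rule imageI)
  have c01: "continuous_on (A0 i) (\<lambda>x. k1 j (h0 i x))" for i j
    using h0S by (intro continuous_on_compose2[OF homeomorphism_cont2[OF hk1(1)] homeomorphism_cont1[OF hk0(1)]]
        image_subsetI)
  have c10: "continuous_on (A1 (Suc i)) (\<lambda>x. k0 j (h1 i x))" for i j
    using h1S by (intro continuous_on_compose2[OF homeomorphism_cont2[OF hk0(1)] homeomorphism_cont1[OF hk1(1)]]
        image_subsetI)
  \<comment> \<open>The shift by one skips the single sphere, which the retraction collapses to the
    base point.\<close>
  have "h_dominated (\<Union>j. A0 j) (\<Union>j. A1 j)"
  proof (rule h_dominated_wedge[where \<sigma> = Suc and f = "\<lambda>j x. k1 j (h0 j x)" and g = "\<lambda>j x. k0 j (h1 j x)",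
      OF A0.compact_wedge_axioms A1.compact_wedge_axioms inj_Suc])
    show "(\<lambda>x. k1 j (h0 j x)) ` A0 j \<subseteq> A1 (Suc j)" "(\<lambda>x. k0 j (h1 j x)) ` A1 (Suc j) \<subseteq> A0 j" for j
      by (intro image_subsetI k1A h0S k0A h1S; assumption)+
    show "k0 j (h1 j (k1 j (h0 j x))) = x" if "x \<in> A0 j" for j x
      using homeomorphism_apply2[OF hk1(1) h0S[OF that]] homeomorphism_apply1[OF hk0(1) that] by simp
  qed (use c01 c10 hk0(2) hk1(2) k0 k1 in simp_all)
  moreover have "h_dominated (\<Union>j. A1 j) (\<Union>j. A0 j)"
  proof -
    \<comment> \<open>The single sphere embeds as the first axis of piece 0, and the first
      projection retracts onto it; the other pieces correspond index by index.\<close>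
    define f where "f j = (case j of 0 \<Rightarrow> (\<lambda>x. k0 0 (a x, p)) | Suc i \<Rightarrow> (\<lambda>x. k0 (Suc i) (h1 i x)))" for j
    define g where "g j = (case j of 0 \<Rightarrow> (\<lambda>x. b (fst (h0 0 x))) | Suc i \<Rightarrow> (\<lambda>x. k1 i (h0 (Suc i) x)))" for j
    have ap: "(a x, p) \<in> ?S \<times> ?S" if "x \<in> A1 0" for x
      using aS[OF that] p(1) by blast
    have fh: "fst (h0 0 x) \<in> ?S" if "x \<in> A0 0" for x
      using h0S[OF that] by (rule mem_Times_iff[THEN iffD1, THEN conjunct1])
    show ?thesis
    proof (rule h_dominated_wedge[where \<sigma> = id and f = f and g = g,
        OF A1.compact_wedge_axioms A0.compact_wedge_axioms inj_on_id])
      fix j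
      show "continuous_on (A1 j) (f j)"
      proof (cases j)
        case 0
        have "continuous_on (A1 0) (\<lambda>x. k0 0 (a x, p))"
        proof (rule continuous_on_compose2[of "?S \<times> ?S" "k0 0"])
          show "continuous_on (A1 0) (\<lambda>x. (a x, p))"
            by (intro continuous_on_Pair homeomorphism_cont1[OF ab(1)] continuous_on_const)
          show "(\<lambda>x. (a x, p)) ` A1 0 \<subseteq> ?S \<times> ?S"
            by (intro image_subsetI ap)
        qed (rule homeomorphism_cont2[OF hk0(1)])
        then show ?thesis
          using 0 by (simp add: f_def)
      qed (simp add: f_def c10)
      show "continuous_on (A0 (id j)) (g j)"
      proof (cases j)
        case 0
        have "continuous_on (A0 0) (\<lambda>x. b (fst (h0 0 x)))"
        proof (rule continuous_on_compose2[of ?S b])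
          show "continuous_on (A0 0) (\<lambda>x. fst (h0 0 x))"
            by (intro continuous_on_fst homeomorphism_cont1[OF hk0(1)])
          show "(\<lambda>x. fst (h0 0 x)) ` A0 0 \<subseteq> ?S"
            by (intro image_subsetI fh)
        qed (rule homeomorphism_cont2[OF ab(1)])
        then show ?thesis
          using 0 by (simp add: g_def)
      qed (simp add: g_def c01)
      show "f j ` A1 j \<subseteq> A0 (id j)"
        using k0A[OF ap] k0A[OF h1S] by (cases j) (simp_all add: f_def image_subset_iff)
      show "g j ` A0 (id j) \<subseteq> A1 j"
        using bA[OF fh] k1A[OF h0S] by (cases j) (simp_all add: g_def image_subset_iff)
      show "f j 0 = 0" "g j 0 = 0"
        using ab(2) b0 k0 k1 hk0(2) hk1(2) by (simp_all add: f_def g_def split: nat.split)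
      show "g j (f j x) = x" if "x \<in> A1 j" for x
      proof (cases j)
        case 0
        then have x: "x \<in> A1 0"
          using that by simp
        have "h0 0 (k0 0 (a x, p)) = (a x, p)"
          by (rule homeomorphism_apply2[OF hk0(1) ap[OF x]])
        then show ?thesis
          using 0 homeomorphism_apply1[OF ab(1) x] by (simp add: f_def g_def)
      next
        case (Suc i)
        then have x: "x \<in> A1 (Suc i)"
          using that by simp
        then show ?thesis
          using homeomorphism_apply2[OF hk0(1) h1S[OF x], of "Suc i"] homeomorphism_apply1[OF hk1(1) x] Suc
          by (simp add: f_def g_def)
      qed
    qed
  qed
  ultimately have "h_equal (\<Union>j. A0 j) (\<Union>j. A1 j)"
    unfolding h_equal_def by blast
  moreover have "\<not> (\<Union>j. A0 j) homotopy_eqv (\<Union>j. A1 j)"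
  proof -
    have dim2: "DIM('b) \<ge> 2"
      using dim by simp
    obtain \<pi> :: "'b \<times> 'b \<Rightarrow> 'b \<times> 'b" and Y c where \<pi>:
      "ANR Y" "continuous_on (?S \<times> ?S) \<pi>" "\<pi> \<in> ?S \<times> ?S \<rightarrow> Y"
      "\<And>x y. x \<in> ?S \<Longrightarrow> y \<in> ?S \<Longrightarrow> x \<bullet> p \<le> 0 \<or> y \<bullet> p \<le> 0 \<Longrightarrow> \<pi> (x, y) = c"
      "\<And>e. \<not> homotopic_with_canon (\<lambda>h. True) (?S \<times> ?S) Y \<pi> (\<lambda>_. e)"
      "\<And>m :: 'b \<Rightarrow> 'b \<times> 'b. continuous_on ?S m \<Longrightarrow> m \<in> ?S \<rightarrow> Y \<Longrightarrow>
         \<exists>e. homotopic_with_canon (\<lambda>h. True) ?S Y m (\<lambda>_. e)"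
      by (rule exists_collapse_map[OF dim2 p(1)]) (rule that; assumption)
    interpret collapse_map p \<pi> Y c
      by unfold_locales (fact dim p(1) \<pi>(1-4))+
    have "\<not> null \<pi>"
      using \<pi>(5) unfolding null_def by blast
    then show ?thesis
      by (rule not_homotopy_eqv[OF A0.compact_wedge_axioms A1.compact_wedge_axioms hk0 ab']) (rule \<pi>(6))
  qed
  ultimately show ?thesis ..
qed

end
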